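(* Let $i\in\{1,2,3,4\}$ and consider the map $F_i$, with $a>1$ if $i\in\{1,2,3\}$ and $a<-1$ if $i=4$, and with $b=b^*(a)$. Then the sequence $\{\varphi_n\}_n$ is not uniformly convergent, and for every (nondegenerate) interval $I\subset\mathbb T$ $$\limsup_{n\to\infty}L(\varphi_n|_I)=+\infty.$$
   Context: Maps. $\mathbb T=\mathbb R/2\pi\mathbb Z$, $\omega\notin 2\pi\mathbb Q$, and $g:\mathbb T\to\mathbb R$ is of class $C^{1+\tau}$ for some $\tau>0$. For $i=1,2,3,4$, $F_i:\mathbb R\times\mathbb T\to\mathbb R\times\mathbb T$ is $F_i(x,\theta)=(h_i(x)+\sigma_i b\,g(\theta),\ \theta+\omega)$ with $\sigma_1=\sigma_4=-1$, $\sigma_2=\sigma_3=1$, and - $h_1(x)=-\frac{\pi}{2}$ if $x<-\frac{\pi}{2a}$, $h_1(x)=ax$ if $|x|\le\frac{\pi}{2a}$, $h_1(x)=\frac{\pi}{2}$ if $x>\frac{\pi}{2a}$; - $h_2(x)=a(x+\delta)$ if $x<-\delta$, $h_2(x)=0$ if $|x|\le\delta$, $h_2(x)=a(x-\delta)$ if $x>\delta$ (here $\delta>0$ is fixed); - $h_3(x)=ax$ if $x>-\frac1a$, $h_3(x)=-1$ if $x\le-\frac1a$; - $h_4(x)=ax$ if $x>\frac1a$, $h_4(x)=1$ if $x\le\frac1a$. Put $\mathcal F_i(\varphi)(\theta)=h_i(\varphi(\theta-\omega))+\sigma_i b\,g(\theta-\omega)$ for $\varphi:\mathbb T\to\mathbb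 R$. Curves. $\mu_i$ is the continuous solution of: $\mu_1(\theta+\omega)=a\mu_1(\theta)-bg(\theta)$; $\mu_2(\theta+\omega)=a(\mu_2(\theta)-\delta)+bg(\theta)$; $\mu_3(\theta+\omega)=a\mu_3(\theta)+bg(\theta)$; $\mu_4(\theta+\omega)=a\mu_4(\theta)-bg(\theta)$. Also $\hat\mu_2$ is the continuous solution of $\hat\mu_2(\theta+\omega)=a(\hat\mu_2(\theta)+\delta)+bg(\theta)$ and $\tilde\gamma_1(\theta)=-\frac\pi2-bg(\theta-\omega)$. The initial curve $\varphi_0$ is: $\frac\pi2-bg(\theta-\omega)$ for $i=1$; $bg(\theta-\omega)$ for $i=2$; $-1+bg(\theta-\omega)$ for $i=3$; $1-bg(\theta-\omega)$ for $i=4$. For $n\ge0$, $\varphi_{n+1}=\mathcal F_i(\varphi_n)$ if $i=1,2,3$ and $\varphi_{n+1}=\mathcal F_4^2(\varphi_n)$ if $i=4$. Put $\lambda_0=\varphi_0-\mu_i$ if $i=1,4$ and $\lambda_0=\mu_i-\varphi_0$ if $i=2,3$. For a real function $f$ on an interval (or on $\mathbb T$), $L(f)=\sup_{x\ne y}|f(x)-f(y)|/|x-y|$ is its smallest Lipschitz constant. Bifurcation value. $b^*(a)$ (assumed to exist) is the smallest $b>0$ for which the following graphs meet: for $i=1$, the graph of $\mu_1$ and the graph of $\varphi_0$ or of $\tilde\gamma_1$; for $i=2$, the graph of $\varphi_0$ and the graph of $\mu_2$ or of $\hat\mu_2$; for $i=3,4$, the graphs of $\varphi_0$ and $\mu_i$.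 Standing assumptions at $b=b^*(a)$. The set $Z_{\lambda_0}=\{\theta\in\mathbb T\mid\lambda_0(\theta)=0\}$ is nonempty, and at least one of the following holds: (A) $g$ is analytic; (B) for every $\theta_0\in Z_{\lambda_0}$ there exist $\varepsilon>0$ and an even integer $m>0$ such that $\lambda_0(\theta)=(\theta-\theta_0)^m q(\theta)$ for $\theta\in(\theta_0-\varepsilon,\theta_0+\varepsilon)$, with $q>0$ on this interval.
   Formalization: g is assumed non-constant (for constant g with nonempty zero set all φ_n are constant and the claim fails), and in (B) the factor q is assumed continuous (otherwise infinitely flat zeros are allowed, for which φ_n can converge uniformly). *)

theory Defs
  imports "HOL-Analysis.Analysis"
begin

text \<open>
  Functions on the circle \<open>\<real> / 2\<pi>\<int>\<close> are represented by their
  \<open>2\<pi>\<close>-periodic lifts \<open>real \<Rightarrow> real\<close>; the parameters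
  are always listed in the order \<open>g \<omega> \<delta> a b\<close>.
\<close>

definition circle_fun :: "(real \<Rightarrow> real) \<Rightarrow> bool" where
  "circle_fun f \<longleftrightarrow> (\<forall>\<theta>. f (\<theta> + 2 * pi) = f \<theta>)"

text \<open>Class \<open>C\<^sup>1\<^sup>+\<^sup>\<tau>\<close>, meant for \<open>0 < \<tau> \<le> 1\<close>:
  the derivative exists and is Hoelder with exponent \<open>\<tau>\<close>.\<close>

definition C1_hoelder :: "real \<Rightarrow> (real \<Rightarrow> real) \<Rightarrow> bool" where
  "C1_hoelder \<tau> f \<longleftrightarrow>
     (\<exists>f' C. (\<forall>x. (f has_real_derivative f' x) (at x)) \<and>
             (\<forall>x y. \<bar>f' x - f' y\<bar> \<le> C * \<bar>x - y\<bar> powr \<tau>))"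

definition real_analytic :: "(real \<Rightarrow> real) \<Rightarrow> bool" where
  "real_analytic f \<longleftrightarrow>
     (\<forall>x0. \<exists>r>0. \<exists>c :: nat \<Rightarrow> real.
        \<forall>x. \<bar>x - x0\<bar> < r \<longrightarrow> (\<lambda>n. c n * (x - x0) ^ n) sums f x)"

definition lip_const :: "real set \<Rightarrow> (real \<Rightarrow> real) \<Rightarrow> ereal" where
  "lip_const S f =
     (SUP (x, y) \<in> {(x, y). x \<in> S \<and> y \<in> S \<and> x \<noteq> y}. ereal (\<bar>f x - f y\<bar> / \<bar>x - y\<bar>))"

datatype map_index = F1 | F2 | F3 | F4

fun fibre_map :: "map_index \<Rightarrow> real \<Rightarrow> real \<Rightarrow> real \<Rightarrow> real" where
  "fibre_map F1 \<delta> a x =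
     (if x < - (pi / (2 * a)) then - (pi / 2)
      else if \<bar>x\<bar> \<le> pi / (2 * a) then a * x else pi / 2)"
| "fibre_map F2 \<delta> a x =
     (if x < - \<delta> then a * (x + \<delta>)
      else if \<bar>x\<bar> \<le> \<delta> then 0 else a * (x - \<delta>))"
| "fibre_map F3 \<delta> a x = (if x > - (1 / a) then a * x else - 1)"
| "fibre_map F4 \<delta> a x = (if x > 1 / a then a * x else 1)"

fun forcing_sign :: "map_index \<Rightarrow> real" where
  "forcing_sign F1 = - 1"
| "forcing_sign F2 = 1"
| "forcing_sign F3 = 1"
| "forcing_sign F4 = - 1"

definition skew_map ::
  "map_index \<Rightarrow> (real \<Rightarrow> real) \<Rightarrow> real \<Rightarrow> real \<Rightarrow> real \<Rightarrow> real \<Rightarrow> real \<times> real \<Rightarrow> real \<times> real" where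
  "skew_map i g \<omega> \<delta> a b = (\<lambda>(x, \<theta>). (fibre_map i \<delta> a x + forcing_sign i * b * g \<theta>, \<theta> + \<omega>))"

definition graph_transform ::
  "map_index \<Rightarrow> (real \<Rightarrow> real) \<Rightarrow> real \<Rightarrow> real \<Rightarrow> real \<Rightarrow> real \<Rightarrow> (real \<Rightarrow> real) \<Rightarrow> (real \<Rightarrow> real)" where
  "graph_transform i g \<omega> \<delta> a b \<phi> = (\<lambda>\<theta>. fst (skew_map i g \<omega> \<delta> a b (\<phi> (\<theta> - \<omega>), \<theta> - \<omega>)))"

text \<open>The continuous solution on the circle of \<open>\<mu> (\<theta> + \<omega>) = G \<theta> (\<mu> \<theta>)\<close>.
  It exists and is unique in every use below, where \<open>G \<theta>\<close> is affine with slope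
  \<open>a\<close>, \<open>\<bar>a\<bar> > 1\<close>, and depends continuously and periodically on \<open>\<theta>\<close>.\<close>

definition circle_solution :: "real \<Rightarrow> (real \<Rightarrow> real \<Rightarrow> real) \<Rightarrow> real \<Rightarrow> real" where
  "circle_solution \<omega> G =
     (THE \<mu>. circle_fun \<mu> \<and> continuous_on UNIV \<mu> \<and> (\<forall>\<theta>. \<mu> (\<theta> + \<omega>) = G \<theta> (\<mu> \<theta>)))"

fun mu :: "map_index \<Rightarrow> (real \<Rightarrow> real) \<Rightarrow> real \<Rightarrow> real \<Rightarrow> real \<Rightarrow> real \<Rightarrow> real \<Rightarrow> real" where
  "mu F1 g \<omega> \<delta> a b = circle_solution \<omega> (\<lambda>\<theta> x. a * x - b * g \<theta>)"
| "mu F2 g \<omega> \<delta> a b = circle_solution \<omega> (\<lambda>\<theta> x. a * (x - \<delta>) + b * g \<theta>)"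
| "mu F3 g \<omega> \<delta> a b = circle_solution \<omega> (\<lambda>\<theta> x. a * x + b * g \<theta>)"
| "mu F4 g \<omega> \<delta> a b = circle_solution \<omega> (\<lambda>\<theta> x. a * x - b * g \<theta>)"

definition mu2_hat :: "(real \<Rightarrow> real) \<Rightarrow> real \<Rightarrow> real \<Rightarrow> real \<Rightarrow> real \<Rightarrow> real \<Rightarrow> real" where
  "mu2_hat g \<omega> \<delta> a b = circle_solution \<omega> (\<lambda>\<theta> x. a * (x + \<delta>) + b * g \<theta>)"

definition gamma1_tilde :: "(real \<Rightarrow> real) \<Rightarrow> real \<Rightarrow> real \<Rightarrow> real \<Rightarrow> real" where
  "gamma1_tilde g \<omega> b \<theta> = - (pi / 2) - b * g (\<theta> - \<omega>)"

fun phi0 :: "map_index \<Rightarrow> (real \<Rightarrow> real) \<Rightarrow> real \<Rightarrow> real \<Rightarrow> real \<Rightarrow> real" where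
  "phi0 F1 g \<omega> b \<theta> = pi / 2 - b * g (\<theta> - \<omega>)"
| "phi0 F2 g \<omega> b \<theta> = b * g (\<theta> - \<omega>)"
| "phi0 F3 g \<omega> b \<theta> = - 1 + b * g (\<theta> - \<omega>)"
| "phi0 F4 g \<omega> b \<theta> = 1 - b * g (\<theta> - \<omega>)"

primrec phi :: "map_index \<Rightarrow> (real \<Rightarrow> real) \<Rightarrow> real \<Rightarrow> real \<Rightarrow> real \<Rightarrow> real \<Rightarrow> nat \<Rightarrow> real \<Rightarrow> real" where
  "phi i g \<omega> \<delta> a b 0 = phi0 i g \<omega> b"
| "phi i g \<omega> \<delta> a b (Suc n) =
     (if i = F4
      then graph_transform i g \<omega> \<delta> a b (graph_transform i g \<omega> \<delta> a b (phi i g \<omega> \<delta> a b n))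
      else graph_transform i g \<omega> \<delta> a b (phi i g \<omega> \<delta> a b n))"

definition lambda0 ::
  "map_index \<Rightarrow> (real \<Rightarrow> real) \<Rightarrow> real \<Rightarrow> real \<Rightarrow> real \<Rightarrow> real \<Rightarrow> real \<Rightarrow> real" where
  "lambda0 i g \<omega> \<delta> a b \<theta> =
     (if i = F1 \<or> i = F4
      then phi0 i g \<omega> b \<theta> - mu i g \<omega> \<delta> a b \<theta>
      else mu i g \<omega> \<delta> a b \<theta> - phi0 i g \<omega> b \<theta>)"

definition zero_set :: "(real \<Rightarrow> real) \<Rightarrow> real set" where
  "zero_set f = {\<theta>. f \<theta> = 0}"

definition graphs_meet :: "(real \<Rightarrow> real) \<Rightarrow> (real \<Rightarrow> real) \<Rightarrow> bool" where
  "graphs_meet f h \<longleftrightarrow> (\<exists>\<theta>. f \<theta> = h \<theta>)"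

fun collision :: "map_index \<Rightarrow> (real \<Rightarrow> real) \<Rightarrow> real \<Rightarrow> real \<Rightarrow> real \<Rightarrow> real \<Rightarrow> bool" where
  "collision F1 g \<omega> \<delta> a b \<longleftrightarrow>
     graphs_meet (mu F1 g \<omega> \<delta> a b) (phi0 F1 g \<omega> b) \<or>
     graphs_meet (mu F1 g \<omega> \<delta> a b) (gamma1_tilde g \<omega> b)"
| "collision F2 g \<omega> \<delta> a b \<longleftrightarrow>
     graphs_meet (phi0 F2 g \<omega> b) (mu F2 g \<omega> \<delta> a b) \<or>
     graphs_meet (phi0 F2 g \<omega> b) (mu2_hat g \<omega> \<delta> a b)"
| "collision F3 g \<omega> \<delta> a b \<longleftrightarrow> graphs_meet (phi0 F3 g \<omega> b) (mu F3 g \<omega> \<delta> a b)"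
| "collision F4 g \<omega> \<delta> a b \<longleftrightarrow> graphs_meet (phi0 F4 g \<omega> b) (mu F4 g \<omega> \<delta> a b)"

text \<open>\<open>b\<close> is the bifurcation value \<open>b\<^sup>* a\<close>; the predicate form includes
  the assumption that this minimum exists.\<close>

definition is_bifurcation_value ::
  "map_index \<Rightarrow> (real \<Rightarrow> real) \<Rightarrow> real \<Rightarrow> real \<Rightarrow> real \<Rightarrow> real \<Rightarrow> bool" where
  "is_bifurcation_value i g \<omega> \<delta> a b \<longleftrightarrow>
     b > 0 \<and> collision i g \<omega> \<delta> a b \<and> (\<forall>b'>0. collision i g \<omega> \<delta> a b' \<longrightarrow> b \<le> b')"

text \<open>The factor \<open>q\<close> is required to be continuous: without any regularity at
  \<open>\<theta>0\<close>, positivity of \<open>q\<close> would put no bound on the order of vanishing.\<close>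

definition even_order_zeros :: "(real \<Rightarrow> real) \<Rightarrow> bool" where
  "even_order_zeros f \<longleftrightarrow>
     (\<forall>\<theta>0 \<in> zero_set f. \<exists>\<epsilon>>0. \<exists>m q. even m \<and> m > (0::nat) \<and>
        continuous_on {\<theta>0 - \<epsilon> <..< \<theta>0 + \<epsilon>} q \<and>
        (\<forall>\<theta> \<in> {\<theta>0 - \<epsilon> <..< \<theta>0 + \<epsilon>}. q \<theta> > 0 \<and> f \<theta> = (\<theta> - \<theta>0) ^ m * q \<theta>))"

end

theory Submission
  imports Defs "HOL-Complex_Analysis.Complex_Analysis"
begin

text \<open>
  Let \<open>D n\<close> be the distance between \<open>\<phi>\<^sub>n\<close> and \<open>\<mu>\<close>, so that \<open>D 0 = \<lambda>\<^sub>0\<close>. Minimality of \<open>b\<close> gives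
  \<open>\<lambda>\<^sub>0 \<ge> 0\<close>, because \<open>\<lambda>\<^sub>0\<close> is affine in \<open>b\<close> and positive at \<open>b = 0\<close>. The piecewise affine form of
  the maps yields \<open>min (a * D n \<theta>) (\<lambda>\<^sub>0 (\<theta> + \<omega>)) \<le> D (n + 1) (\<theta> + \<omega>)\<close> (with \<open>a\<^sup>2\<close>, \<open>2 * \<omega>\<close> in
  place of \<open>a\<close>, \<open>\<omega>\<close> for the fourth family), and zeros of \<open>D n\<close> are carried by the rotation to zeros
  of \<open>D (n + 1)\<close>. Thus \<open>D n \<theta>\<close> is at least the minimum of \<open>a ^ k * \<lambda>\<^sub>0 (\<theta> - k * \<omega>)\<close> over \<open>k \<le> n\<close>.
  As \<open>\<lambda>\<^sub>0\<close> has only zeros of finite order, a Borel--Cantelli argument bounds this minimum below by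
  a positive constant independent of \<open>n\<close>, for some \<open>\<theta>\<close> in any given interval. On the other hand the
  orbit of a zero of \<open>\<lambda>\<^sub>0\<close> is dense, so for infinitely many \<open>n\<close> there is a zero of \<open>D n\<close> as close to
  this \<open>\<theta>\<close> as desired. This oscillation excludes uniform convergence and makes the Lipschitz
  constants unbounded.
\<close>

section \<open>Rotations of the circle\<close>

lemma circle_fun_add_int:
  assumes "circle_fun f"
  shows "f (x + 2 * pi * of_int p) = f x"
proof -
  have *: "f (y + 2 * pi * real n) = f y" for y n
  proof (induction n)
    case (Suc n)
    have "f (y + 2 * pi * real (Suc n)) = f ((y + 2 * pi * real n) + 2 * pi)"
      by (simp add: algebra_simps)
    with Suc assms show ?case by (simp add: circle_fun_def)
  qed simp
  show ?thesis
  proof (cases "p \<ge> 0")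
    case True
    then show ?thesis using *[of x "nat p"] by simp
  next
    case False
    then show ?thesis using *[of "x + 2 * pi * of_int p" "nat (- p)"] by simp
  qed
qed

text \<open>Compactness of one period. The radius may depend on the centre, so local bounds become
  uniform by a minimum or maximum over \<open>X\<close>.\<close>

lemma circle_finite_cover:
  fixes \<epsilon> :: "real \<Rightarrow> real"
  assumes "\<And>x. \<epsilon> x > 0"
  obtains X where "finite X" "X \<noteq> {}"
    "\<And>t. \<exists>x\<in>X. \<exists>p::int. \<bar>t - 2 * pi * of_int p - x\<bar> < \<epsilon> x"
proof -
  have "{0..2 * pi} \<subseteq> (\<Union>x\<in>{0..2 * pi}. ball x (\<epsilon> x))" using assms by fastforce
  then obtain X where X: "finite X" "{0..2 * pi} \<subseteq> (\<Union>x\<in>X. ball x (\<epsilon> x))"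
    by (rule compactE_image[of "{0..2 * pi}" "{0..2 * pi}" "\<lambda>x. ball x (\<epsilon> x)", rotated 2]) auto
  have "\<exists>x\<in>X. \<exists>p::int. \<bar>t - 2 * pi * of_int p - x\<bar> < \<epsilon> x" for t
  proof -
    define p where "p = \<lfloor>t / (2 * pi)\<rfloor>"
    have "of_int p \<le> t / (2 * pi)" "t / (2 * pi) < of_int p + 1"
      unfolding p_def by linarith+
    hence "t - 2 * pi * of_int p \<in> {0..2 * pi}"
      by (auto simp: field_simps)
    then obtain x where "x \<in> X" "t - 2 * pi * of_int p \<in> ball x (\<epsilon> x)" using X(2) by blast
    then show ?thesis by (auto simp: dist_real_def abs_minus_commute intro!: bexI[of _ x] exI[of _ p])
  qed
  moreover from this have "X \<noteq> {}" by blast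
  ultimately show ?thesis using X(1) that by blast
qed

lemma circle_fun_bounded:
  assumes "circle_fun f" "continuous_on UNIV f"
  obtains M :: real where "M > 0" "\<And>x. \<bar>f x\<bar> \<le> M"
proof -
  have "\<exists>d>0. \<forall>y. \<bar>y - x\<bar> < d \<longrightarrow> \<bar>f y\<bar> \<le> \<bar>f x\<bar> + 1" for x
  proof -
    obtain d where "d > 0" "\<forall>y. dist y x < d \<longrightarrow> dist (f y) (f x) < 1"
      using assms(2) by (metis UNIV_I continuous_on_iff zero_less_one)
    then show ?thesis by (intro exI[of _ d]) (force simp: dist_real_def)
  qed
  then obtain d where d: "\<And>x. d x > 0" "\<And>x y. \<bar>y - x\<bar> < d x \<Longrightarrow> \<bar>f y\<bar> \<le> \<bar>f x\<bar> + 1"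
    by metis
  from circle_finite_cover[of d, OF d(1)] obtain X where X: "finite X" "X \<noteq> {}"
    "\<And>t. \<exists>x\<in>X. \<exists>p::int. \<bar>t - 2 * pi * of_int p - x\<bar> < d x" by blast
  define M where "M = Max ((\<lambda>x. \<bar>f x\<bar> + 1) ` X)"
  have M: "\<bar>f x\<bar> + 1 \<le> M" if "x \<in> X" for x unfolding M_def using X(1) that by simp
  have "\<bar>f t\<bar> \<le> M" for t
  proof -
    obtain x and p :: int where "x \<in> X" "\<bar>t - 2 * pi * of_int p - x\<bar> < d x" using X(3) by blast
    with d(2)[of "t - 2 * pi * of_int p" x] M[of x] have "\<bar>f (t - 2 * pi * of_int p)\<bar> \<le> M" by linarith
    then show ?thesis using circle_fun_add_int[OF assms(1), of t "- p"] by simp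
  qed
  moreover have "M > 0" using X(2) M by fastforce
  ultimately show ?thesis using that by blast
qed

text \<open>Density of fractional parts, applied to the target turned back by \<open>N\<close>
  rotations: a positive hitting time \<open>k\<close> there becomes the hitting time
  \<open>N + k\<close> for \<open>x\<close>.\<close>

lemma rotation_orbit_dense:
  fixes \<Omega> x y \<epsilon> :: real
  assumes "\<Omega> / (2 * pi) \<notin> \<rat>" "\<epsilon> > 0"
  shows "\<exists>n\<ge>N. \<exists>p::int. \<bar>y + real n * \<Omega> + 2 * pi * of_int p - x\<bar> < \<epsilon>"
proof -
  obtain h k :: int where hk: "k > 0"
    "\<bar>of_int k * (\<Omega> / (2 * pi)) - of_int h - (x - y - N * \<Omega>) / (2 * pi)\<bar> < \<epsilon> / (2 * pi)"
    using sequence_of_fractional_parts_is_dense[OF assms(1), of "\<epsilon> / (2 * pi)" "(x - y - N * \<Omega>) / (2 * pi)"]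
      assms(2) by (metis divide_pos_pos mult_pos_pos pi_gt_zero zero_less_numeral)
  have "of_int k * (\<Omega> / (2 * pi)) - of_int h - (x - y - N * \<Omega>) / (2 * pi)
      = (y + real (N + nat k) * \<Omega> + 2 * pi * of_int (- h) - x) / (2 * pi)"
    using hk(1) by (simp add: field_simps)
  with hk(2) have "\<bar>y + real (N + nat k) * \<Omega> + 2 * pi * of_int (- h) - x\<bar> < \<epsilon>"
    by (simp add: abs_divide divide_less_cancel)
  then show ?thesis by (intro exI[of _ "N + nat k"]) (auto intro!: exI[of _ "- h"])
qed

section \<open>Shrinking targets and slow recurrence\<close>

text \<open>The targets of stage \<open>k\<close> have total length of order \<open>\<eta> * r ^ k\<close> in the
  interval, so for small \<open>\<eta>\<close> they do not cover it.\<close>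

lemma exists_avoiding_shrinking_targets:
  fixes \<alpha> \<beta> r :: real and c :: "nat \<Rightarrow> 'b \<Rightarrow> real"
  assumes "\<alpha> < \<beta>" "0 < r" "r < 1" "finite P"
  obtains t \<eta> where "\<alpha> < t" "t < \<beta>" "\<eta> > 0"
    "\<And>k x p. x \<in> P \<Longrightarrow> \<eta> * r ^ k \<le> \<bar>t - c k x - 2 * pi * of_int p\<bar>"
proof -
  define l where "l = min (\<beta> - \<alpha>) 1"
  have l: "0 < l" "l \<le> 1" "l \<le> \<beta> - \<alpha>" using assms(1) by (auto simp: l_def)
  \<comment> \<open>The intervals of all stages together have length at most
    \<open>2 * card P * \<eta> / (1 - r)\<close>, which this choice keeps below
    \<open>l / 2\<close>.\<close>
  define \<eta> where "\<eta> = l * (1 - r) / (4 * (real (card P) + 1))"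
  have eta: "0 < \<eta>" using l assms by (simp add: \<eta>_def)
  have eta1: "\<eta> \<le> 1"
  proof -
    have "l * (1 - r) \<le> 1 * 1" using l assms by (intro mult_mono) auto
    then show ?thesis unfolding \<eta>_def by (simp add: field_simps)
  qed
  \<comment> \<open>Only translates of a target in a bounded window around \<open>\<alpha>\<close>
    matter; as \<open>4 < 2 * pi\<close>, the window contains at most one of them.\<close>
  define near where "near k x y \<longleftrightarrow> (\<exists>p::int. y = c k x + 2 * pi * of_int p) \<and> \<bar>y - \<alpha>\<bar> \<le> 2" for k x y
  have near_unique: "y = y'" if near: "near k x y" "near k x y'" for k x y y'
  proof -
    obtain p p' :: int where p: "y = c k x + 2 * pi * of_int p" "y' = c k x + 2 * pi * of_int p'"
      using near unfolding near_def by blast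
    have "\<bar>y - y'\<bar> \<le> 4" using that by (auto simp: near_def)
    hence "2 * pi * \<bar>of_int (p - p')\<bar> \<le> 4" using p by (simp add: algebra_simps abs_if split: if_splits)
    moreover have "2 * pi * 1 \<le> 2 * pi * \<bar>of_int (p - p') :: real\<bar>" if "p \<noteq> p'"
      using that pi_ge_zero by (intro mult_left_mono) linarith+
    ultimately have "p = p'" using pi_gt3 by linarith
    then show ?thesis using p by simp
  qed
  \<comment> \<open>If no translate is near, \<open>q k x\<close> is arbitrary. This merely adds one
    more interval to \<open>B k\<close>, which the measure bound counts anyway.\<close>
  define q where "q k x = (SOME y. near k x y)" for k x
  define B where "B k = (\<Union>x\<in>P. {q k x - \<eta> * r ^ k .. q k x + \<eta> * r ^ k})" for k
  have B_sets: "B k \<in> sets lborel" for k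
    unfolding B_def using assms(4) by (intro sets.finite_UN) auto
  have emB: "emeasure lborel (B k) \<le> ennreal ((2 * real (card P) * \<eta>) * r ^ k)" for k
  proof -
    have nn: "0 \<le> \<eta> * r ^ k" using eta assms by simp
    have "emeasure lborel (B k) \<le> (\<Sum>x\<in>P. emeasure lborel {q k x - \<eta> * r ^ k .. q k x + \<eta> * r ^ k})"
      unfolding B_def by (rule emeasure_subadditive_finite) (auto simp: assms)
    also have "\<dots> = (\<Sum>x\<in>P. ennreal (2 * (\<eta> * r ^ k)))"
      using nn by (intro sum.cong) auto
    also have "\<dots> = ennreal ((2 * real (card P) * \<eta>) * r ^ k)"
      using nn by (simp add: ennreal_of_nat_eq_real_of_nat ennreal_mult'[symmetric] mult_ac)
    finally show ?thesis .
  qed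
  have "emeasure lborel (\<Union>k. B k) \<le> (\<Sum>k. emeasure lborel (B k))"
    by (rule emeasure_subadditive_countably) (use B_sets in auto)
  also have "\<dots> \<le> (\<Sum>k. ennreal ((2 * real (card P) * \<eta>) * r ^ k))"
    by (intro suminf_le emB) auto
  also have "\<dots> = ennreal ((2 * real (card P) * \<eta>) * (1 / (1 - r)))"
    using eta assms by (intro suminf_ennreal_eq sums_mult geometric_sums) auto
  also have "\<dots> < ennreal l"
  proof (rule ennreal_lessI[OF l(1)])
    have "(2 * real (card P) * \<eta>) * (1 / (1 - r)) = l * (real (card P) / (2 * (real (card P) + 1)))"
    proof -
      have "(2 * N * (l * u / (4 * (N + 1)))) * (1 / u) = l * (N / (2 * (N + 1)))"
        if "u \<noteq> 0" "N + 1 \<noteq> 0" for u N :: real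
        using that by (simp add: divide_simps)
      from this[of "1 - r" "real (card P)"] show ?thesis unfolding \<eta>_def using assms(3) by simp
    qed
    also have "\<dots> < l * 1" using l by (intro mult_strict_left_mono) (auto simp: field_simps)
    finally show "(2 * real (card P) * \<eta>) * (1 / (1 - r)) < l" by simp
  qed
  also have "\<dots> = emeasure lborel {\<alpha><..<\<alpha> + l}" using l by simp
  finally have small: "emeasure lborel (\<Union>k. B k) < emeasure lborel {\<alpha><..<\<alpha> + l}" .
  have "(\<Union>k. B k) \<in> sets lborel" using B_sets by (intro sets.countable_nat_UN) auto
  from emeasure_mono[OF _ this] have "\<not> {\<alpha><..<\<alpha> + l} \<subseteq> (\<Union>k. B k)"
    using small by (meson leD)
  then obtain t where t: "\<alpha> < t" "t < \<alpha> + l" "\<And>k. t \<notin> B k"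
    unfolding subset_iff UN_iff greaterThanLessThan_iff by blast
  show ?thesis
  proof (rule that[of t \<eta>])
    fix k x and p :: int assume x: "x \<in> P"
    show "\<eta> * r ^ k \<le> \<bar>t - c k x - 2 * pi * of_int p\<bar>"
    proof (rule ccontr)
      assume *: "\<not> ?thesis"
      \<comment> \<open>A translate this close to \<open>t\<close> is within 1 of \<open>t\<close>,
        and \<open>t\<close> is within \<open>l \<le> 1\<close> of \<open>\<alpha>\<close>, so it
        lies in the window of \<open>near\<close>.\<close>
      have "\<eta> * r ^ k \<le> 1" using eta eta1 assms by (intro mult_le_one) (auto simp: power_le_one)
      hence n: "near k x (c k x + 2 * pi * of_int p)"
        using * t l unfolding near_def by auto
      hence "q k x = c k x + 2 * pi * of_int p"
        unfolding q_def using near_unique someI[of "near k x"] by blast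
      hence "t \<in> B k" unfolding B_def using * x by (auto intro!: bexI[of _ x])
      with t(3) show False by blast
    qed
  qed (use t l eta in auto)
qed

text \<open>The bound is asked at every point and not only at zeros, which suits a compactness
  argument; where a continuous \<open>f\<close> does not vanish, \<open>m = 0\<close>
  serves.\<close>

definition finite_order_zeros :: "(real \<Rightarrow> real) \<Rightarrow> bool" where
  "finite_order_zeros f \<longleftrightarrow>
     (\<forall>x. \<exists>\<epsilon>>0. \<exists>c>0. \<exists>m. \<forall>t. \<bar>t - x\<bar> < \<epsilon> \<longrightarrow> c * \<bar>t - x\<bar> ^ m \<le> \<bar>f t\<bar>)"

text \<open>Over a finite cover, take the least constant and an exponent above all local ones: for
  distances below 1 a larger exponent weakens the bound. The \<open>Suc\<close> in \<open>m'\<close>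
  makes the exponent positive, so that roots of that order can be taken.\<close>

lemma finite_order_zeros_circle_bound:
  assumes "circle_fun f" "finite_order_zeros f"
  obtains c m P where "c > 0" "m > 0" "finite P"
    "\<And>t. \<exists>x\<in>P. \<exists>p::int. c * \<bar>t - 2 * pi * of_int p - x\<bar> ^ m \<le> \<bar>f t\<bar>"
proof -
  obtain \<epsilon> c m where e: "\<And>x. \<epsilon> x > 0" "\<And>x. c x > 0"
    "\<And>x t. \<bar>t - x\<bar> < \<epsilon> x \<Longrightarrow> c x * \<bar>t - x\<bar> ^ m x \<le> \<bar>f t\<bar>"
    using assms(2) unfolding finite_order_zeros_def by metis
  from circle_finite_cover[of "\<lambda>x. min (\<epsilon> x) 1"] e(1) obtain X where X: "finite X" "X \<noteq> {}"
    "\<And>t. \<exists>x\<in>X. \<exists>p::int. \<bar>t - 2 * pi * of_int p - x\<bar> < min (\<epsilon> x) 1"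
    by (metis min_less_iff_conj zero_less_one)
  define C where "C = Min (c ` X)"
  define m' where "m' = Suc (Max (m ` X))"
  have C: "C > 0" using X e(2) by (auto simp: C_def)
  have *: "\<exists>x\<in>X. \<exists>p::int. C * \<bar>t - 2 * pi * of_int p - x\<bar> ^ m' \<le> \<bar>f t\<bar>" for t
  proof -
    obtain x and p :: int where x: "x \<in> X" "\<bar>t - 2 * pi * of_int p - x\<bar> < min (\<epsilon> x) 1" using X(3) by blast
    let ?d = "\<bar>t - 2 * pi * of_int p - x\<bar>"
    have "m x \<le> m'" unfolding m'_def using x X by (simp add: le_SucI)
    hence "?d ^ m' \<le> ?d ^ m x" using x by (intro power_decreasing) auto
    moreover have "C \<le> c x" unfolding C_def using x X by simp
    ultimately have "C * ?d ^ m' \<le> c x * ?d ^ m x" using C by (intro mult_mono) auto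
    also have "\<dots> \<le> \<bar>f (t - 2 * pi * of_int p)\<bar>" using e(3) x(2) by simp
    also have "f (t - 2 * pi * of_int p) = f t" using circle_fun_add_int[OF assms(1), of t "- p"] by simp
    finally show ?thesis using x(1) by blast
  qed
  show ?thesis by (rule that[OF C _ X(1) *]) (simp add: m'_def)
qed

text \<open>The targets are the points of \<open>P\<close> carried along by the rotation. With
  \<open>r ^ m = 1 / A\<close>, staying \<open>\<eta> * r ^ k\<close> away from them bounds
  \<open>f\<close> below by \<open>c * \<eta> ^ m / A ^ k\<close>, and the factor
  \<open>A ^ k\<close> cancels this decay.\<close>

lemma exists_slow_recurrence:
  fixes A \<Omega> \<alpha> \<beta> :: real
  assumes "circle_fun f" "finite_order_zeros f" "A > 1" "\<alpha> < \<beta>"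
  obtains t c where "\<alpha> < t" "t < \<beta>" "c > 0" "\<And>k. c \<le> A ^ k * \<bar>f (t - real k * \<Omega>)\<bar>"
proof -
  obtain c m P where P: "c > 0" "m > 0" "finite P"
    "\<And>t. \<exists>x\<in>P. \<exists>p::int. c * \<bar>t - 2 * pi * of_int p - x\<bar> ^ m \<le> \<bar>f t\<bar>"
    using finite_order_zeros_circle_bound[OF assms(1,2)] by blast
  define r where "r = root m (1 / A)"
  have r: "0 < r" "r < 1" "r ^ m = 1 / A" using assms(3) P(2) by (auto simp: r_def)
  obtain t \<eta> where t: "\<alpha> < t" "t < \<beta>" "\<eta> > 0"
    "\<And>k x p. x \<in> P \<Longrightarrow> \<eta> * r ^ k \<le> \<bar>t - (real k * \<Omega> + x) - 2 * pi * of_int p\<bar>"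
    using exists_avoiding_shrinking_targets[OF assms(4) r(1,2) P(3), of "\<lambda>k x. real k * \<Omega> + x"] by metis
  have "c * \<eta> ^ m \<le> A ^ k * \<bar>f (t - real k * \<Omega>)\<bar>" for k
  proof -
    obtain x and p :: int where x: "x \<in> P"
      "c * \<bar>(t - real k * \<Omega>) - 2 * pi * of_int p - x\<bar> ^ m \<le> \<bar>f (t - real k * \<Omega>)\<bar>"
      using P(4) by blast
    have "(\<eta> * r ^ k) ^ m \<le> \<bar>(t - real k * \<Omega>) - 2 * pi * of_int p - x\<bar> ^ m"
      using t(3) t(4)[OF x(1), of k p] r by (intro power_mono) (auto simp: algebra_simps)
    hence "c * (\<eta> * r ^ k) ^ m \<le> \<bar>f (t - real k * \<Omega>)\<bar>"
      using x(2) P(1) by (meson mult_le_cancel_left_pos order_trans)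
    moreover have "(\<eta> * r ^ k) ^ m = \<eta> ^ m / A ^ k"
      using r(3) by (simp add: power_mult_distrib power_mult[symmetric] mult.commute[of k m])
         (simp add: power_mult power_divide)
    ultimately have "c * (\<eta> ^ m / A ^ k) \<le> \<bar>f (t - real k * \<Omega>)\<bar>" by metis
    then show ?thesis using assms(3) by (simp add: field_simps)
  qed
  with t P show ?thesis by (intro that[of t "c * \<eta> ^ m"]) auto
qed

section \<open>Cohomological equations over a rotation\<close>

text \<open>Rewriting \<open>m (\<theta> + \<omega>) = a * m \<theta> + g \<theta>\<close> as
  \<open>m \<theta> = (m (\<theta> + \<omega>) - g \<theta>) / a\<close> and iterating forwards
  gives this series, which converges for bounded \<open>g\<close> because a is expanding.\<close>

definition cohom_sol :: "real \<Rightarrow> real \<Rightarrow> (real \<Rightarrow> real) \<Rightarrow> real \<Rightarrow> real" where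
  "cohom_sol a \<omega> g \<theta> = - (\<Sum>k. g (\<theta> + real k * \<omega>) / a ^ Suc k)"

lemma summable_geometric_bound:
  fixes a M :: real
  assumes "\<bar>a\<bar> > 1"
  shows "summable (\<lambda>k. M / \<bar>a\<bar> ^ Suc k)"
proof -
  have "summable (\<lambda>k. (M / \<bar>a\<bar>) * (1 / \<bar>a\<bar>) ^ k)"
    using assms by (intro summable_mult summable_geometric) auto
  then show ?thesis by (simp add: power_divide field_simps)
qed

text \<open>A geometric majorant and the Weierstrass test give continuity; the functional equation
  is a shift of the summation index.\<close>

lemma cohom_sol_props:
  assumes "\<bar>a\<bar> > 1" "circle_fun g" "continuous_on UNIV g"
  shows circle_fun_cohom_sol: "circle_fun (cohom_sol a \<omega> g)"
    and continuous_cohom_sol: "continuous_on UNIV (cohom_sol a \<omega> g)"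
    and cohom_sol_eq: "cohom_sol a \<omega> g (\<theta> + \<omega>) = a * cohom_sol a \<omega> g \<theta> + g \<theta>"
proof -
  obtain M where M: "\<And>x. \<bar>g x\<bar> \<le> M" using circle_fun_bounded[OF assms(2,3)] by blast
  define u where "u \<theta> k = g (\<theta> + real k * \<omega>) / a ^ Suc k" for \<theta> k
  have bd: "norm (u \<theta> k) \<le> M / \<bar>a\<bar> ^ Suc k" for \<theta> k
    unfolding u_def using M by (simp add: power_abs divide_right_mono abs_mult)
  have sm: "summable (u \<theta>)" for \<theta>
    by (rule summable_comparison_test'[OF summable_geometric_bound[OF assms(1)] bd])
  have eq: "cohom_sol a \<omega> g = (\<lambda>\<theta>. - (\<Sum>k. u \<theta> k))" by (simp add: cohom_sol_def u_def fun_eq_iff)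
  have "u (\<theta> + 2 * pi) = u \<theta>" for \<theta>
  proof
    fix k
    have "g (\<theta> + 2 * pi + real k * \<omega>) = g ((\<theta> + real k * \<omega>) + 2 * pi)" by (simp add: algebra_simps)
    then show "u (\<theta> + 2 * pi) k = u \<theta> k" using assms(2) by (simp add: u_def circle_fun_def)
  qed
  then show "circle_fun (cohom_sol a \<omega> g)" by (simp add: circle_fun_def eq)
  have "uniform_limit UNIV (\<lambda>n \<theta>. \<Sum>k<n. u \<theta> k) (\<lambda>\<theta>. \<Sum>k. u \<theta> k) sequentially"
    by (rule Weierstrass_m_test[OF bd summable_geometric_bound[OF assms(1)]])
  moreover have "continuous_on UNIV (\<lambda>\<theta>. \<Sum>k<n. u \<theta> k)" for n
    unfolding u_def by (intro continuous_intros continuous_on_compose2[OF assms(3)]) (use assms(1) in auto)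
  ultimately have "continuous_on UNIV (\<lambda>\<theta>. \<Sum>k. u \<theta> k)"
    by (intro uniform_limit_theorem[of _ "\<lambda>n \<theta>. \<Sum>k<n. u \<theta> k"]) auto
  then show "continuous_on UNIV (cohom_sol a \<omega> g)" unfolding eq by (intro continuous_intros)
  have "u (\<theta> + \<omega>) k = a * u \<theta> (Suc k)" for k
    using assms(1) unfolding u_def by (simp add: algebra_simps)
  hence "(\<Sum>k. u (\<theta> + \<omega>) k) = a * (\<Sum>k. u \<theta> (Suc k))"
    using sm by (simp add: suminf_mult[OF summable_Suc_iff[THEN iffD2]])
  also have "\<dots> = a * ((\<Sum>k. u \<theta> k) - u \<theta> 0)"
    by (simp only: suminf_split_head[OF sm[of \<theta>]])
  also have "\<dots> = a * (\<Sum>k. u \<theta> k) - g \<theta>"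
  proof -
    have "u \<theta> 0 = g \<theta> / a" by (simp add: u_def)
    then show ?thesis using assms(1) by (simp only: right_diff_distrib) auto
  qed
  finally show "cohom_sol a \<omega> g (\<theta> + \<omega>) = a * cohom_sol a \<omega> g \<theta> + g \<theta>"
    by (simp add: eq)
qed

text \<open>The difference of two solutions is multiplied by \<open>a\<close> at each rotation, so
  it grows without bound along an orbit unless it vanishes, whereas continuous functions on the
  circle are bounded.\<close>

lemma circle_solution_unique:
  assumes "\<bar>a\<bar> > 1" "circle_fun \<mu>" "continuous_on UNIV \<mu>" "\<And>\<theta>. \<mu> (\<theta> + \<omega>) = a * \<mu> \<theta> + f \<theta>"
    "circle_fun \<nu>" "continuous_on UNIV \<nu>" "\<And>\<theta>. \<nu> (\<theta> + \<omega>) = a * \<nu> \<theta> + f \<theta>"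
  shows "\<mu> = \<nu>"
proof
  fix \<theta>
  obtain M where M: "\<And>x. \<bar>\<mu> x\<bar> \<le> M" using circle_fun_bounded[OF assms(2,3)] by blast
  obtain N where N: "\<And>x. \<bar>\<nu> x\<bar> \<le> N" using circle_fun_bounded[OF assms(5,6)] by blast
  have *: "\<mu> (\<theta> + real n * \<omega>) - \<nu> (\<theta> + real n * \<omega>) = a ^ n * (\<mu> \<theta> - \<nu> \<theta>)" for n
  proof (induction n)
    case (Suc n)
    have "\<mu> ((\<theta> + real n * \<omega>) + \<omega>) - \<nu> ((\<theta> + real n * \<omega>) + \<omega>) = a * (\<mu> (\<theta> + real n * \<omega>) - \<nu> (\<theta> + real n * \<omega>))"
      unfolding assms(4,7) by (simp add: algebra_simps)
    also have "\<dots> = a ^ Suc n * (\<mu> \<theta> - \<nu> \<theta>)" by (simp only: Suc power_Suc mult.assoc)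
    finally show ?case by (simp add: distrib_right add.assoc add.commute[of "real n * \<omega>"])
  qed simp
  have **: "\<bar>a\<bar> ^ n * \<bar>\<mu> \<theta> - \<nu> \<theta>\<bar> \<le> M + N" for n
  proof -
    have "\<bar>a\<bar> ^ n * \<bar>\<mu> \<theta> - \<nu> \<theta>\<bar> = \<bar>\<mu> (\<theta> + real n * \<omega>) - \<nu> (\<theta> + real n * \<omega>)\<bar>"
      by (simp add: * abs_mult power_abs)
    then show ?thesis using M[of "\<theta> + real n * \<omega>"] N[of "\<theta> + real n * \<omega>"] by linarith
  qed
  show "\<mu> \<theta> = \<nu> \<theta>"
  proof (rule ccontr)
    assume "\<mu> \<theta> \<noteq> \<nu> \<theta>"
    moreover obtain n where "(M + N) / \<bar>\<mu> \<theta> - \<nu> \<theta>\<bar> < \<bar>a\<bar> ^ n"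
      using real_arch_pow[OF assms(1)] by blast
    ultimately show False using **[of n] by (simp add: field_simps)
  qed
qed

text \<open>By linearity the forcing contributes a multiple of \<open>cohom_sol\<close>, and the
  constant contributes the fixed point of \<open>x \<mapsto> a * x + c\<close>. Uniqueness is what
  allows the definite description to be evaluated.\<close>

lemma circle_solution_affine:
  assumes "\<bar>a\<bar> > 1" "circle_fun g" "continuous_on UNIV g"
    and "\<And>\<theta> x. G \<theta> x = a * x + c + d * g \<theta>"
  shows "circle_solution \<omega> G = (\<lambda>\<theta>. c / (1 - a) + d * cohom_sol a \<omega> g \<theta>)"
proof -
  define \<mu> where "\<mu> = (\<lambda>\<theta>. c / (1 - a) + d * cohom_sol a \<omega> g \<theta>)"
  have a: "a \<noteq> 1" using assms(1) by auto
  have 1: "circle_fun \<mu>" using circle_fun_cohom_sol[OF assms(1-3)] by (simp add: circle_fun_def \<mu>_def)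
  have 2: "continuous_on UNIV \<mu>" unfolding \<mu>_def by (intro continuous_intros continuous_cohom_sol assms)
  have 3: "\<mu> (\<theta> + \<omega>) = a * \<mu> \<theta> + (c + d * g \<theta>)" for \<theta>
  proof -
    have "c / (1 - a) = a * (c / (1 - a)) + c" using a by (simp add: divide_simps) (simp add: algebra_simps)
    then show ?thesis unfolding cohom_sol_eq[OF assms(1-3)] \<mu>_def by (simp only: distrib_left mult.left_commute)
  qed
  have "circle_solution \<omega> G = \<mu>" unfolding circle_solution_def
  proof (rule the_equality)
    show "circle_fun \<mu> \<and> continuous_on UNIV \<mu> \<and> (\<forall>\<theta>. \<mu> (\<theta> + \<omega>) = G \<theta> (\<mu> \<theta>))"
      using 1 2 3 assms(4) by auto
    fix \<nu> assume \<nu>: "circle_fun \<nu> \<and> continuous_on UNIV \<nu> \<and> (\<forall>\<theta>. \<nu> (\<theta> + \<omega>) = G \<theta> (\<nu> \<theta>))"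
    hence "\<nu> (\<theta> + \<omega>) = a * \<nu> \<theta> + (c + d * g \<theta>)" for \<theta> using assms(4) by auto
    then show "\<nu> = \<mu>"
      using circle_solution_unique[OF assms(1), of \<nu> \<omega> "\<lambda>\<theta>. c + d * g \<theta>" \<mu>] \<nu> 1 2 3 by simp
  qed
  then show ?thesis unfolding \<mu>_def .
qed

section \<open>Holomorphic extensions and orders of zeros\<close>

text \<open>Real analyticity in a form stable under uniform limits: convergence of the complex
  extensions on discs replaces estimates on Taylor coefficients.\<close>

definition holo_ext :: "(real \<Rightarrow> real) \<Rightarrow> bool" where
  "holo_ext f \<longleftrightarrow> (\<forall>x. \<exists>r>0. \<exists>F. F holomorphic_on ball (of_real x) r \<and>
     (\<forall>t. \<bar>t - x\<bar> < r \<longrightarrow> F (of_real t) = complex_of_real (f t)))"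

text \<open>The same power series is read in a complex variable.\<close>

lemma real_analytic_imp_holo_ext:
  assumes "real_analytic g"
  shows "holo_ext g"
  unfolding holo_ext_def
proof
  fix x
  obtain r c where r: "r > 0" "\<And>t. \<bar>t - x\<bar> < r \<Longrightarrow> (\<lambda>n. c n * (t - x) ^ n) sums g t"
    using assms unfolding real_analytic_def by metis
  define F where "F z = (\<Sum>n. complex_of_real (c n) * (z - of_real x) ^ n)" for z
  have sm: "summable (\<lambda>n. complex_of_real (c n) * (z - of_real x) ^ n)" if z: "z \<in> ball (of_real x) r" for z
  proof -
    \<comment> \<open>A real radius strictly between \<open>cmod (z - x)\<close> and
      \<open>r\<close>: convergence at \<open>x + s\<close> gives absolute convergence at
      \<open>z\<close>.\<close>
    define s where "s = (cmod (z - of_real x) + r) / 2"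
    have s: "cmod (z - of_real x) < s" "0 < s" "s < r"
      using z r(1) unfolding s_def by (auto simp: dist_norm norm_minus_commute intro: add_nonneg_pos)
    have "summable (\<lambda>n. c n * s ^ n)" using r(2)[of "x + s"] s by (auto simp: sums_iff)
    hence "summable (\<lambda>n. norm (c n * (cmod (z - of_real x)) ^ n))"
      by (rule powser_insidea) (use s in auto)
    hence "summable (\<lambda>n. norm (complex_of_real (c n) * (z - of_real x) ^ n))"
      by (simp add: norm_mult norm_power abs_mult)
    then show ?thesis by (rule summable_norm_cancel)
  qed
  have "F holomorphic_on ball (of_real x) r"
    by (rule power_series_holomorphic[where a = "\<lambda>n. complex_of_real (c n)"])
      (use sm in \<open>auto simp: F_def intro: summable_sums\<close>)
  moreover have "F (of_real t) = of_real (g t)" if "\<bar>t - x\<bar> < r" for t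
  proof -
    have "(\<lambda>n. complex_of_real (c n * (t - x) ^ n)) sums of_real (g t)"
      using r(2)[OF that] by (rule sums_of_real)
    then show ?thesis unfolding F_def by (simp add: sums_iff)
  qed
  ultimately show "\<exists>r>0. \<exists>F. F holomorphic_on ball (of_real x) r \<and>
     (\<forall>t. \<bar>t - x\<bar> < r \<longrightarrow> F (of_real t) = complex_of_real (g t))" using r(1) by blast
qed

text \<open>Translation by a multiple of \<open>2 * pi\<close> brings every point near one of
  finitely many centres. Covering with radius \<open>r x / 4\<close> leaves room for a disc of
  common radius inside the half disc, where the extension is bounded by compactness.\<close>

lemma holo_ext_circle_uniform:
  assumes "circle_fun g" "holo_ext g"
  obtains \<rho> M F where "\<rho> > 0" "\<And>x::real. F x holomorphic_on ball (of_real x) \<rho>"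
    "\<And>x z. z \<in> ball (of_real x) \<rho> \<Longrightarrow> cmod (F x z) \<le> M"
    "\<And>x t. \<bar>t - x\<bar> < \<rho> \<Longrightarrow> F x (of_real t) = complex_of_real (g t)"
proof -
  obtain r F where F: "\<And>x. r x > 0" "\<And>x. F x holomorphic_on ball (of_real x) (r x)"
     "\<And>x t. \<bar>t - x\<bar> < r x \<Longrightarrow> F x (of_real t) = complex_of_real (g t)"
    using assms(2) unfolding holo_ext_def by metis
  have "\<exists>M. \<forall>z\<in>cball (of_real x) (r x / 2). cmod (F x z) \<le> M" for x
  proof -
    have "continuous_on (cball (of_real x) (r x / 2)) (F x)"
      by (rule continuous_on_subset[OF holomorphic_on_imp_continuous_on[OF F(2)]]) (use F(1)[of x] in auto)
    hence "bounded (F x ` cball (of_real x) (r x / 2))"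
      by (intro compact_imp_bounded compact_continuous_image) auto
    then show ?thesis unfolding bounded_iff by blast
  qed
  then obtain M where M: "\<And>x z. z \<in> cball (of_real x) (r x / 2) \<Longrightarrow> cmod (F x z) \<le> M x" by metis
  from circle_finite_cover[of "\<lambda>x. r x / 4"] F(1) obtain X where X: "finite X" "X \<noteq> {}"
    "\<And>t. \<exists>x\<in>X. \<exists>p::int. \<bar>t - 2 * pi * of_int p - x\<bar> < r x / 4"
    by (metis zero_less_divide_iff zero_less_numeral)
  then obtain c and p :: "real \<Rightarrow> int" where
    c: "\<And>t. c t \<in> X" "\<And>t. \<bar>t - 2 * pi * of_int (p t) - c t\<bar> < r (c t) / 4" by metis
  define \<rho> where "\<rho> = Min ((\<lambda>x. r x / 4) ` X)"
  define B where "B = Max (M ` X)"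
  have rho: "\<rho> > 0" unfolding \<rho>_def using X F(1) by simp
  have rho_le: "\<rho> \<le> r x / 4" if "x \<in> X" for x
    unfolding \<rho>_def using X(1) that by (intro Min_le) auto
  define T where "T x z = z - complex_of_real (2 * pi * of_int (p x))" for x z
  have T: "T x z \<in> cball (of_real (c x)) (r (c x) / 2)" if z: "z \<in> ball (of_real x) \<rho>" for x z
  proof -
    have "cmod (T x z - of_real (c x)) =
      cmod ((z - of_real x) + of_real (x - 2 * pi * of_int (p x) - c x))" by (simp add: T_def algebra_simps)
    also have "\<dots> \<le> cmod (z - of_real x) + \<bar>x - 2 * pi * of_int (p x) - c x\<bar>"
      by (metis norm_of_real norm_triangle_ineq)
    also have "\<dots> \<le> r (c x) / 2"
      using c(2)[of x] rho_le[OF c(1)[of x]] z by (simp add: dist_norm norm_minus_commute)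
    finally show ?thesis by (simp add: dist_norm norm_minus_commute)
  qed
  show ?thesis
  proof (rule that[OF rho, of "\<lambda>x z. F (c x) (T x z)" B])
    fix x :: real
    have "T x ` ball (of_real x) \<rho> \<subseteq> ball (of_real (c x)) (r (c x))"
      using T[of _ x] F(1)[of "c x"] by fastforce
    moreover have "T x holomorphic_on ball (of_real x) \<rho>"
      unfolding T_def by (intro holomorphic_intros)
    ultimately show "(\<lambda>z. F (c x) (T x z)) holomorphic_on ball (of_real x) \<rho>"
      using holomorphic_on_compose_gen[OF _ F(2)] by (simp add: o_def)
    fix z :: complex assume "z \<in> ball (of_real x) \<rho>"
    from M[OF T[OF this]] have "cmod (F (c x) (T x z)) \<le> M (c x)" .
    also have "\<dots> \<le> B" unfolding B_def using X(1) c(1) by simp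
    finally show "cmod (F (c x) (T x z)) \<le> B" .
  next
    fix x t :: real assume t: "\<bar>t - x\<bar> < \<rho>"
    have "\<bar>t - 2 * pi * of_int (p x) - c x\<bar> < r (c x)"
      using t c(2)[of x] rho_le[OF c(1)[of x]] by linarith
    from F(3)[OF this] show "F (c x) (T x (of_real t)) = complex_of_real (g t)"
      using circle_fun_add_int[OF assms(1), of t "- p x"] by (simp add: T_def)
  qed
qed

text \<open>The common radius and bound along the orbit of \<open>x\<close> let all terms of the
  series extend to one disc with a geometric majorant, so the sum is a uniform limit of holomorphic
  functions.\<close>

lemma holo_ext_cohom_sol:
  assumes "\<bar>a\<bar> > 1" "circle_fun g" "continuous_on UNIV g" "holo_ext g"
  shows "holo_ext (cohom_sol a \<omega> g)"
proof -
  obtain \<rho> M F where F: "\<rho> > 0" "\<And>x::real. F x holomorphic_on ball (of_real x) \<rho>"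
    "\<And>x z. z \<in> ball (of_real x) \<rho> \<Longrightarrow> cmod (F x z) \<le> M"
    "\<And>x t. \<bar>t - x\<bar> < \<rho> \<Longrightarrow> F x (of_real t) = complex_of_real (g t)"
    by (rule holo_ext_circle_uniform[OF assms(2,4)]) blast
  show ?thesis unfolding holo_ext_def
  proof
    fix x :: real
    let ?B = "ball (complex_of_real x) \<rho>"
    define u where "u k z = F (x + real k * \<omega>) (z + of_real (real k * \<omega>)) / of_real (a ^ Suc k)" for k z
    have sh: "z + of_real (real k * \<omega>) \<in> ball (of_real (x + real k * \<omega>)) \<rho>" if "z \<in> ?B" for z k
      using that by (simp add: dist_norm)
    have bd: "norm (u k z) \<le> M / \<bar>a\<bar> ^ Suc k" if "z \<in> ?B" for k z
      using F(3)[OF sh[OF that, of k]] unfolding u_def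
      by (simp add: norm_divide norm_mult norm_power divide_right_mono)
    have ul: "uniform_limit ?B (\<lambda>n z. \<Sum>k<n. u k z) (\<lambda>z. \<Sum>k. u k z) sequentially"
      by (rule Weierstrass_m_test[OF bd summable_geometric_bound[OF assms(1)]])
    have hu: "u k holomorphic_on ?B" for k
    proof -
      have "(\<lambda>z. z + of_real (real k * \<omega>)) holomorphic_on ?B"
        by (intro holomorphic_intros)
      moreover have "(\<lambda>z. z + of_real (real k * \<omega>)) ` ?B \<subseteq> ball (of_real (x + real k * \<omega>)) \<rho>"
        using sh by blast
      ultimately have "(\<lambda>z. F (x + real k * \<omega>) (z + of_real (real k * \<omega>))) holomorphic_on ?B"
        using holomorphic_on_compose_gen[OF _ F(2)[of "x + real k * \<omega>"]] unfolding o_def by blast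
      then show ?thesis unfolding u_def using assms(1) by (intro holomorphic_intros) auto
    qed
    have "(\<lambda>z. \<Sum>k. u k z) holomorphic_on ?B"
    proof (rule holomorphic_uniform_sequence[where f = "\<lambda>n z. \<Sum>k<n. u k z"])
      show "(\<lambda>z. \<Sum>k<n. u k z) holomorphic_on ?B" for n using hu by (intro holomorphic_intros)
      fix z assume "z \<in> ?B"
      then obtain d where "d > 0" "cball z d \<subseteq> ?B" by (meson open_ball open_contains_cball)
      then show "\<exists>d>0. cball z d \<subseteq> ?B \<and>
          uniform_limit (cball z d) (\<lambda>n z. \<Sum>k<n. u k z) (\<lambda>z. \<Sum>k. u k z) sequentially"
        using uniform_limit_on_subset[OF ul] by blast
    qed simp
    moreover have "(\<Sum>k. u k (of_real t)) = - complex_of_real (cohom_sol a \<omega> g t)" if "\<bar>t - x\<bar> < \<rho>" for t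
    proof -
      have t: "complex_of_real t \<in> ?B" using that by (simp add: dist_of_real dist_real_def abs_minus_commute)
      have eq: "u k (of_real t) = of_real (g (t + real k * \<omega>) / a ^ Suc k)" for k
        using F(4)[of "t + real k * \<omega>" "x + real k * \<omega>"] that by (simp add: u_def)
      have "summable (\<lambda>k. u k (of_real t))"
        by (rule summable_comparison_test'[OF summable_geometric_bound[OF assms(1)] bd[OF t]])
      hence "summable (\<lambda>k. g (t + real k * \<omega>) / a ^ Suc k)"
        unfolding eq by (simp only: summable_of_real_iff)
      hence "(\<Sum>k. complex_of_real (g (t + real k * \<omega>) / a ^ Suc k))
          = of_real (\<Sum>k. g (t + real k * \<omega>) / a ^ Suc k)"
        by (simp only: suminf_of_real)
      then show ?thesis unfolding eq by (simp add: cohom_sol_def)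
    qed
    ultimately show "\<exists>r>0. \<exists>H. H holomorphic_on ball (of_real x) r \<and>
     (\<forall>t. \<bar>t - x\<bar> < r \<longrightarrow> H (of_real t) = complex_of_real (cohom_sol a \<omega> g t))"
      using F(1) by (intro exI[of _ \<rho>] conjI exI[of _ "\<lambda>z. - (\<Sum>k. u k z)"] holomorphic_intros) auto
  qed
qed

lemma holo_ext_affine_shift:
  assumes "holo_ext f"
  shows "holo_ext (\<lambda>t. c + d * f (t - s))"
  unfolding holo_ext_def
proof
  fix x :: real
  obtain r F where F: "r > 0" "F holomorphic_on ball (of_real (x - s)) r"
    "\<And>t. \<bar>t - (x - s)\<bar> < r \<Longrightarrow> F (of_real t) = complex_of_real (f t)"
    using assms unfolding holo_ext_def by blast
  have "(\<lambda>z. z - complex_of_real s) ` ball (of_real x) r \<subseteq> ball (of_real (x - s)) r"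
    by (auto simp: dist_norm)
  hence "(\<lambda>z. F (z - of_real s)) holomorphic_on ball (of_real x) r"
    using holomorphic_on_compose_gen[OF _ F(2), of "\<lambda>z. z - of_real s" "ball (of_real x) r"]
    by (simp add: o_def holomorphic_intros)
  hence "(\<lambda>z. of_real c + of_real d * F (z - of_real s)) holomorphic_on ball (of_real x) r"
    by (intro holomorphic_intros)
  moreover have "of_real c + of_real d * F (of_real t - of_real s) = complex_of_real (c + d * f (t - s))"
    if "\<bar>t - x\<bar> < r" for t
    using F(3)[of "t - s"] that by simp
  ultimately show "\<exists>r>0. \<exists>F. F holomorphic_on ball (of_real x) r \<and>
     (\<forall>t. \<bar>t - x\<bar> < r \<longrightarrow> F (of_real t) = complex_of_real (c + d * f (t - s)))"
    using F(1) by (intro exI[of _ r] conjI exI[of _ "\<lambda>z. of_real c + of_real d * F (z - of_real s)"]) auto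
qed

text \<open>A nonconstant extension factors at a zero as \<open>(w - x) ^ m * q w\<close> with
  \<open>q\<close> nonvanishing, and continuity keeps \<open>q\<close> above half its central
  modulus. If there is no zero at \<open>x\<close>, the case \<open>m = 0\<close> with
  \<open>q = F\<close> applies.\<close>

lemma holo_ext_zero_dichotomy:
  assumes "holo_ext f"
  shows "(\<exists>\<epsilon>>0. \<forall>t. \<bar>t - x\<bar> < \<epsilon> \<longrightarrow> f t = 0) \<or>
    (\<exists>\<epsilon>>0. \<exists>c>0. \<exists>m. \<forall>t. \<bar>t - x\<bar> < \<epsilon> \<longrightarrow> c * \<bar>t - x\<bar> ^ m \<le> \<bar>f t\<bar>)"
proof -
  obtain r F where F: "r > 0" "F holomorphic_on ball (of_real x) r"
    "\<And>t. \<bar>t - x\<bar> < r \<Longrightarrow> F (of_real t) = complex_of_real (f t)"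
    using assms unfolding holo_ext_def by blast
  have x: "complex_of_real x \<in> ball (of_real x) r" using F(1) by simp
  have lower: ?thesis if q: "0 < s" "s \<le> r" "q holomorphic_on ball (of_real x) s" "q (of_real x) \<noteq> 0"
    "\<And>w. w \<in> ball (of_real x) s \<Longrightarrow> F w = (w - of_real x) ^ m * q w" for s q and m :: nat
  proof -
    have "isCont q (of_real x)"
      using holomorphic_on_imp_continuous_on[OF q(3)] q(1)
      by (meson centre_in_ball continuous_on_eq_continuous_at open_ball)
    then obtain d where d: "d > 0"
      "\<And>w. dist w (of_real x) < d \<Longrightarrow> dist (q w) (q (of_real x)) < cmod (q (of_real x)) / 2"
      using q(4) unfolding continuous_at_eps_delta by (metis half_gt_zero_iff zero_less_norm_iff)
    have "cmod (q (of_real x)) / 2 * \<bar>t - x\<bar> ^ m \<le> \<bar>f t\<bar>" if t: "\<bar>t - x\<bar> < min d s" for t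
    proof -
      have w: "complex_of_real t \<in> ball (of_real x) s" "dist (complex_of_real t) (of_real x) < d"
        using t by (auto simp: dist_of_real dist_real_def abs_minus_commute)
      have "cmod (q (of_real x)) / 2 \<le> cmod (q (of_real t))"
        using d(2)[OF w(2)] norm_triangle_ineq2[of "q (of_real x)" "q (of_real t)"]
        unfolding dist_norm norm_minus_commute[of "q (of_real t)"] by linarith
      hence "cmod (q (of_real x)) / 2 * \<bar>t - x\<bar> ^ m \<le> cmod (q (of_real t)) * \<bar>t - x\<bar> ^ m"
        by (intro mult_right_mono) auto
      also have "\<dots> = cmod (F (of_real t))"
        unfolding q(5)[OF w(1)] by (simp add: norm_mult norm_power flip: of_real_diff)
      also have "\<dots> = \<bar>f t\<bar>" using F(3)[of t] t q(2) by simp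
      finally show ?thesis .
    qed
    then show ?thesis using d(1) q(1,4)
      by (intro disjI2 exI[of _ "min d s"] conjI exI[of _ "cmod (q (of_real x)) / 2"] exI[of _ m]) auto
  qed
  show ?thesis
  proof (cases "F (of_real x) = 0")
    case False
    then show ?thesis using lower[OF F(1) order.refl F(2), of 0] by simp
  next
    case True
    show ?thesis
    proof (cases "F constant_on ball (of_real x) r")
      case True
      hence "F w = 0" if "w \<in> ball (of_real x) r" for w
        using that x \<open>F (of_real x) = 0\<close> unfolding constant_on_def by metis
      hence "f t = 0" if "\<bar>t - x\<bar> < r" for t
        using F(3)[OF that] that by (simp add: dist_of_real dist_real_def abs_minus_commute)
      then show ?thesis using F(1) by blast
    next
      case False
      show ?thesis
      proof (rule holomorphic_factor_zero_nonconstant[OF F(2) open_ball connected_ball x True False])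
        fix q s and m :: nat
        assume q: "0 < m" "0 < s" "ball (complex_of_real x) s \<subseteq> ball (of_real x) r"
          "q holomorphic_on ball (of_real x) s"
          "\<And>w. w \<in> ball (of_real x) s \<Longrightarrow> F w = (w - of_real x) ^ m * q w"
          "\<And>w. w \<in> ball (of_real x) s \<Longrightarrow> q w \<noteq> 0"
        from q(2,3) have "s \<le> r" by (simp add: ball_subset_ball_iff)
        then show ?thesis using q(2,6) by (intro lower[OF q(2) _ q(4) _ q(5)]) auto
      qed
    qed
  qed
qed

text \<open>Identity principle on the line: the set \<open>U\<close> of points near which
  \<open>f\<close> vanishes identically is open, and so is its complement by the dichotomy. It
  misses \<open>y\<close>, so it is empty by connectedness.\<close>

lemma holo_ext_imp_finite_order_zeros:
  assumes "holo_ext f" "f y \<noteq> 0"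
  shows "finite_order_zeros f"
proof -
  define U where "U = {x. \<exists>\<epsilon>>0. \<forall>t. \<bar>t - x\<bar> < \<epsilon> \<longrightarrow> f t = 0}"
  have "open U" unfolding open_dist
  proof
    fix x assume "x \<in> U"
    then obtain \<epsilon> where e: "\<epsilon> > 0" "\<And>t. \<bar>t - x\<bar> < \<epsilon> \<Longrightarrow> f t = 0" by (auto simp: U_def)
    have "z \<in> U" if z: "dist z x < \<epsilon> / 2" for z
    proof -
      have "f t = 0" if "\<bar>t - z\<bar> < \<epsilon> / 2" for t
      proof (rule e(2))
        have "\<bar>z - x\<bar> < \<epsilon> / 2" using z by (simp add: dist_real_def)
        with that show "\<bar>t - x\<bar> < \<epsilon>" by linarith
      qed
      with e(1) show ?thesis by (auto simp: U_def intro!: exI[of _ "\<epsilon> / 2"])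
    qed
    then show "\<exists>e>0. \<forall>z. dist z x < e \<longrightarrow> z \<in> U" using e(1) half_gt_zero by blast
  qed
  moreover have "open (- U)" unfolding open_dist
  proof
    fix x assume "x \<in> - U"
    then obtain \<epsilon> c m where e: "\<epsilon> > 0" "c > 0" "\<And>t. \<bar>t - x\<bar> < \<epsilon> \<Longrightarrow> c * \<bar>t - x\<bar> ^ m \<le> \<bar>f t\<bar>"
      using holo_ext_zero_dichotomy[OF assms(1), of x] by (auto simp: U_def)
    have "z \<notin> U" if z: "dist z x < \<epsilon>" for z
    proof
      assume "z \<in> U"
      then obtain \<eta> where h: "\<eta> > 0" "\<And>t. \<bar>t - z\<bar> < \<eta> \<Longrightarrow> f t = 0" by (auto simp: U_def)
      define s where "s = min \<eta> (\<epsilon> - dist z x) / 2"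
      have s: "0 < s" "s < \<eta>" "s < \<epsilon> - dist z x" using h(1) z by (auto simp: s_def min_def)
      \<comment> \<open>Moving from \<open>z\<close> away from \<open>x\<close> ensures
        \<open>t \<noteq> x\<close>, where the lower bound is strictly positive.\<close>
      define t where "t = (if z \<ge> x then z + s else z - s)"
      have "\<bar>t - z\<bar> < \<eta>" "\<bar>t - x\<bar> < \<epsilon>" "t \<noteq> x"
        using s by (auto simp: t_def dist_real_def)
      moreover from this have "c * \<bar>t - x\<bar> ^ m > 0" using e(2) by simp
      ultimately show False using e(3)[of t] h(2)[of t] by simp
    qed
    then show "\<exists>e>0. \<forall>z. dist z x < e \<longrightarrow> z \<in> - U" using e(1) by blast
  qed
  moreover have "y \<notin> U" using assms(2) by (force simp: U_def)
  ultimately have "U = {}" using clopen[of U] by (auto simp: closed_def)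
  hence "\<not> (\<exists>\<epsilon>>0. \<forall>t. \<bar>t - x\<bar> < \<epsilon> \<longrightarrow> f t = 0)" for x
    unfolding U_def by blast
  then show ?thesis unfolding finite_order_zeros_def
    using holo_ext_zero_dichotomy[OF assms(1)] by meson
qed

text \<open>At a zero, continuity of \<open>q\<close> keeps it above half its central value.
  Elsewhere the same estimate applies with exponent 0 and \<open>f\<close> itself as the
  factor.\<close>

lemma even_order_zeros_imp_finite_order_zeros:
  assumes "continuous_on UNIV f" "even_order_zeros f"
  shows "finite_order_zeros f"
  unfolding finite_order_zeros_def
proof
  fix x
  have lower: "\<exists>\<epsilon>>0. \<exists>c>0. \<exists>m. \<forall>t. \<bar>t - x\<bar> < \<epsilon> \<longrightarrow> c * \<bar>t - x\<bar> ^ m \<le> \<bar>f t\<bar>"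
    if q: "s > 0" "continuous_on {x - s<..<x + s} q" "q x \<noteq> 0"
      "\<And>t. t \<in> {x - s<..<x + s} \<Longrightarrow> f t = (t - x) ^ m * q t" for s q and m :: nat
  proof -
    have "isCont q x" using q(1,2) by (simp add: continuous_on_eq_continuous_at)
    then obtain d where d: "d > 0" "\<And>t. dist t x < d \<Longrightarrow> dist (q t) (q x) < \<bar>q x\<bar> / 2"
      using q(3) unfolding continuous_at_eps_delta by (metis half_gt_zero_iff zero_less_abs_iff)
    have "\<bar>q x\<bar> / 2 * \<bar>t - x\<bar> ^ m \<le> \<bar>f t\<bar>" if t: "\<bar>t - x\<bar> < min d s" for t
    proof -
      have "\<bar>q x\<bar> / 2 \<le> \<bar>q t\<bar>" using d(2)[of t] t unfolding dist_real_def by linarith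
      hence "\<bar>q x\<bar> / 2 * \<bar>t - x\<bar> ^ m \<le> \<bar>q t\<bar> * \<bar>t - x\<bar> ^ m" by (intro mult_right_mono) auto
      also have "\<dots> = \<bar>(t - x) ^ m * q t\<bar>" by (simp add: abs_mult power_abs)
      also have "(t - x) ^ m * q t = f t" using t by (intro q(4)[symmetric]) (simp add: abs_less_iff)
      finally show ?thesis .
    qed
    then show ?thesis using d(1) q(1,3)
      by (intro exI[of _ "min d s"] conjI exI[of _ "\<bar>q x\<bar> / 2"] exI[of _ m]) auto
  qed
  show "\<exists>\<epsilon>>0. \<exists>c>0. \<exists>m. \<forall>t. \<bar>t - x\<bar> < \<epsilon> \<longrightarrow> c * \<bar>t - x\<bar> ^ m \<le> \<bar>f t\<bar>"
  proof (cases "f x = 0")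
    case True
    then obtain s m q where q: "s > 0" "continuous_on {x - s<..<x + s} q"
      "\<forall>t \<in> {x - s<..<x + s}. q t > 0 \<and> f t = (t - x) ^ m * q t"
      using assms(2) unfolding even_order_zeros_def zero_set_def by blast
    have "q x \<noteq> 0" using q(1,3) by (metis add.commute diff_less_eq greaterThanLessThan_iff less_add_same_cancel1 less_irrefl)
    then show ?thesis using lower[OF q(1,2), of m] q(3) by blast
  next
    case False
    then show ?thesis using lower[of 1 f 0] continuous_on_subset[OF assms(1)] by auto
  qed
qed

section \<open>Oscillating sequences\<close>

text \<open>Slow recurrence of the backward orbit of \<open>t\<close> bounds every
  \<open>D n t\<close> below by one constant, while the dense forward orbit of \<open>z\<close>
  brings zeros of \<open>D n\<close> arbitrarily close to \<open>t\<close> for arbitrarily late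
  \<open>n\<close>.\<close>

lemma oscillation_near_slow_point:
  fixes D :: "nat \<Rightarrow> real \<Rightarrow> real"
  assumes "\<Omega> / (2 * pi) \<notin> \<rat>" "A > 1" "circle_fun f" "finite_order_zeros f" "\<And>t. f t \<ge> 0" "f z = 0"
    and "\<And>t. D 0 t = f t"
    and "\<And>n t. D n t \<ge> 0 \<Longrightarrow> min (A * D n t) (f (t + \<Omega>)) \<le> D (Suc n) (t + \<Omega>)"
    and "\<And>n t. D n t = 0 \<Longrightarrow> D (Suc n) (t + \<Omega>) = 0"
    and "\<alpha> < \<beta>"
  shows "\<exists>t c. \<alpha> < t \<and> t < \<beta> \<and> c > 0 \<and> (\<forall>n. c \<le> D n t) \<and>
    (\<forall>\<epsilon> N. \<epsilon> > 0 \<longrightarrow> (\<exists>n\<ge>N. \<exists>y. \<bar>y - t\<bar> < \<epsilon> \<and> D n y = 0))"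
proof -
  obtain t c where t: "\<alpha> < t" "t < \<beta>" "c > 0" "\<And>k. c \<le> A ^ k * \<bar>f (t - real k * \<Omega>)\<bar>"
    by (rule exists_slow_recurrence[OF assms(3,4,2,10), of \<Omega>]) blast
  \<comment> \<open>The comparison is unrolled along the backward orbit, with \<open>s\<close>
    divided by \<open>A\<close> at each step. The condition \<open>0 \<le> s\<close> supplies the
    nonnegativity of \<open>D n\<close> that the comparison asks for.\<close>
  have lower: "s \<le> D n y" if "0 \<le> s" "\<And>k. k \<le> n \<Longrightarrow> s \<le> A ^ k * f (y - real k * \<Omega>)" for n s y
    using that
  proof (induction n arbitrary: s y)
    case 0
    from 0(2)[of 0] show ?case by (simp add: assms(7))
  next
    case (Suc n)
    have sA: "s / A \<le> D n (y - \<Omega>)"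
    proof (rule Suc.IH)
      show "0 \<le> s / A" using Suc.prems(1) assms(2) by simp
      fix k assume "k \<le> n"
      then have "s \<le> A ^ Suc k * f (y - real (Suc k) * \<Omega>)" by (intro Suc.prems(2)) auto
      also have "y - real (Suc k) * \<Omega> = (y - \<Omega>) - real k * \<Omega>" by (simp add: algebra_simps)
      finally show "s / A \<le> A ^ k * f ((y - \<Omega>) - real k * \<Omega>)"
        using assms(2) by (simp add: pos_divide_le_eq mult_ac)
    qed
    moreover from this have "D n (y - \<Omega>) \<ge> 0"
      using Suc.prems(1) assms(2) by (smt (verit) divide_nonneg_pos)
    ultimately have "min (A * D n (y - \<Omega>)) (f y) \<le> D (Suc n) y"
      using assms(8)[of n "y - \<Omega>"] by simp
    moreover have "s \<le> A * D n (y - \<Omega>)" using sA assms(2) by (simp add: pos_divide_le_eq mult.commute)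
    moreover have "s \<le> f y" using Suc.prems(2)[of 0] by simp
    ultimately show ?case by linarith
  qed
  have c: "c \<le> D n t" for n
    using lower[of c n t] t(3,4) assms(5) by simp
  have zero: "D n (y + real n * \<Omega>) = 0" if "f y = 0" for n y
  proof (induction n)
    case (Suc n)
    from assms(9)[OF this] show ?case by (simp add: algebra_simps)
  qed (simp add: that assms(7))
  have "\<exists>n\<ge>N. \<exists>y. \<bar>y - t\<bar> < \<epsilon> \<and> D n y = 0" if e: "\<epsilon> > 0" for \<epsilon> N
  proof -
    obtain n and p :: int where n: "n \<ge> N" "\<bar>z + real n * \<Omega> + 2 * pi * of_int p - t\<bar> < \<epsilon>"
      using rotation_orbit_dense[OF assms(1) e] by blast
    \<comment> \<open>The translation is made in the starting point, where periodicity of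
      \<open>f\<close> is available, since \<open>D n\<close> is not assumed periodic.\<close>
    have "f (z + 2 * pi * of_int p) = 0" using circle_fun_add_int[OF assms(3)] assms(6) by simp
    from zero[OF this, of n] n show ?thesis
      by (intro exI[of _ n] conjI exI[of _ "z + 2 * pi * of_int p + real n * \<Omega>"]) (simp_all add: algebra_simps)
  qed
  with t(1-3) c show ?thesis by blast
qed

text \<open>Near \<open>t\<close> the curve \<open>\<mu>\<close> varies by less than
  \<open>c / 2\<close>, while \<open>D n\<close> falls from at least \<open>c\<close> to 0.\<close>

lemma persistent_oscillation:
  fixes D \<phi> :: "nat \<Rightarrow> real \<Rightarrow> real" and \<mu> :: "real \<Rightarrow> real"
  assumes "continuous_on UNIV \<mu>" "\<bar>s\<bar> = 1" "\<And>n y. \<phi> n y = \<mu> y + s * D n y"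
    and "c > 0" "\<And>n. c \<le> D n t"
    and "\<And>\<epsilon> N. \<epsilon> > 0 \<Longrightarrow> \<exists>n\<ge>N. \<exists>y. \<bar>y - t\<bar> < \<epsilon> \<and> D n y = 0"
    and "\<epsilon> > 0"
  shows "\<exists>n\<ge>N. \<exists>y. \<bar>y - t\<bar> < \<epsilon> \<and> c / 2 \<le> \<bar>\<phi> n y - \<phi> n t\<bar>"
proof -
  obtain d where d: "d > 0" "\<And>y. dist y t < d \<Longrightarrow> dist (\<mu> y) (\<mu> t) < c / 2"
    using assms(1,4) unfolding continuous_on_iff by (metis UNIV_I half_gt_zero)
  obtain n y where n: "n \<ge> N" "\<bar>y - t\<bar> < min \<epsilon> d" "D n y = 0"
    using assms(6)[of "min \<epsilon> d" N] assms(7) d(1) by auto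
  have "\<bar>s * D n t\<bar> = D n t" using assms(2,4) assms(5)[of n] by (simp add: abs_mult)
  hence "c \<le> \<bar>s * D n t\<bar>" using assms(5)[of n] by simp
  moreover have "\<phi> n y - \<phi> n t = (\<mu> y - \<mu> t) - s * D n t" by (simp add: assms(3) n(3))
  moreover have "\<bar>\<mu> y - \<mu> t\<bar> < c / 2" using d(2)[of y] n(2) by (simp add: dist_real_def)
  ultimately have "c / 2 \<le> \<bar>\<phi> n y - \<phi> n t\<bar>" by linarith
  with n show ?thesis by auto
qed

text \<open>A uniform limit would be continuous at \<open>t\<close>; three errors below
  \<open>c / 3\<close> contradict the jump.\<close>

lemma not_uniformly_convergent_if_oscillating:
  fixes \<phi> :: "nat \<Rightarrow> real \<Rightarrow> real"
  assumes "\<And>n. continuous_on UNIV (\<phi> n)" "c > 0"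
    and "\<And>\<epsilon> N. \<epsilon> > 0 \<Longrightarrow> \<exists>n\<ge>N. \<exists>y. \<bar>y - t\<bar> < \<epsilon> \<and> c \<le> \<bar>\<phi> n y - \<phi> n t\<bar>"
  shows "\<not> uniformly_convergent_on UNIV \<phi>"
proof
  assume "uniformly_convergent_on UNIV \<phi>"
  then obtain l where l: "uniform_limit UNIV \<phi> l sequentially" unfolding uniformly_convergent_on_def by blast
  have "continuous_on UNIV l" by (rule uniform_limit_theorem[OF _ l]) (use assms(1) in auto)
  then obtain d where d: "d > 0" "\<And>y. dist y t < d \<Longrightarrow> dist (l y) (l t) < c / 3"
    using assms(2) unfolding continuous_on_iff by (metis UNIV_I divide_pos_pos zero_less_numeral)
  from l have "\<forall>\<^sub>F n in sequentially. \<forall>y\<in>UNIV. dist (\<phi> n y) (l y) < c / 3"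
    by (rule uniform_limitD) (use assms(2) in auto)
  then obtain N where N: "\<And>n y. n \<ge> N \<Longrightarrow> dist (\<phi> n y) (l y) < c / 3"
    unfolding eventually_sequentially by blast
  obtain n y where n: "n \<ge> N" "\<bar>y - t\<bar> < d" "c \<le> \<bar>\<phi> n y - \<phi> n t\<bar>" using assms(3)[OF d(1)] by blast
  show False
    using N[OF n(1), of y] N[OF n(1), of t] d(2)[of y] n(2,3) unfolding dist_real_def by linarith
qed

lemma limsup_lip_const_if_oscillating:
  fixes \<phi> :: "nat \<Rightarrow> real \<Rightarrow> real"
  assumes "c > 0" "\<alpha> < t" "t < \<beta>" "{\<alpha><..<\<beta>} \<subseteq> I"
    and "\<And>\<epsilon> N. \<epsilon> > 0 \<Longrightarrow> \<exists>n\<ge>N. \<exists>y. \<bar>y - t\<bar> < \<epsilon> \<and> c \<le> \<bar>\<phi> n y - \<phi> n t\<bar>"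
  shows "limsup (\<lambda>n. lip_const I (\<phi> n)) = \<infinity>"
proof -
  have *: "\<exists>n\<ge>N. ereal K \<le> lip_const I (\<phi> n)" for K N
  proof -
    \<comment> \<open>The first bound makes the difference quotient at least \<open>K\<close>, the
      other two keep \<open>y\<close> inside the interval.\<close>
    define \<epsilon> where "\<epsilon> = min (c / (\<bar>K\<bar> + 1)) (min (t - \<alpha>) (\<beta> - t))"
    have e: "\<epsilon> > 0" using assms by (simp add: \<epsilon>_def)
    obtain n y where n: "n \<ge> N" "\<bar>y - t\<bar> < \<epsilon>" "c \<le> \<bar>\<phi> n y - \<phi> n t\<bar>" using assms(5)[OF e] by blast
    have y: "y \<noteq> t" using n(3) assms(1) by auto
    have "y \<in> {\<alpha><..<\<beta>}" "t \<in> {\<alpha><..<\<beta>}" using n(2) assms(2,3) by (auto simp: \<epsilon>_def)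
    hence I: "y \<in> I" "t \<in> I" using assms(4) by auto
    have "(\<bar>K\<bar> + 1) * \<bar>y - t\<bar> \<le> c" using n(2) by (auto simp: \<epsilon>_def field_simps)
    hence "K * \<bar>y - t\<bar> \<le> \<bar>\<phi> n y - \<phi> n t\<bar>"
      using n(3) mult_right_mono[of K "\<bar>K\<bar> + 1" "\<bar>y - t\<bar>"] by linarith
    hence "K \<le> \<bar>\<phi> n y - \<phi> n t\<bar> / \<bar>y - t\<bar>" using y by (simp add: pos_le_divide_eq)
    also have "ereal \<dots> \<le> lip_const I (\<phi> n)"
      unfolding lip_const_def using I y by (intro SUP_upper2[of "(y, t)"]) auto
    finally show ?thesis using n(1) by (meson ereal_less_eq(3) order_trans)
  qed
  have "(SUP n\<in>{N..}. lip_const I (\<phi> n)) = \<infinity>" for N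
  proof (rule ereal_top)
    fix K
    from *[where N = N and K = K] show "ereal K \<le> (SUP n\<in>{N..}. lip_const I (\<phi> n))"
      by (meson SUP_upper2 atLeast_iff)
  qed
  then show ?thesis by (simp add: limsup_INF_SUP)
qed

text \<open>This isolates what the dynamics must supply: a one-step comparison with expansion
  \<open>A\<close> over the rotation by \<open>\<Omega>\<close>, and transport of zeros. All four
  families are then instances.\<close>

lemma conclusion_from_comparison:
  fixes D \<phi> :: "nat \<Rightarrow> real \<Rightarrow> real"
  assumes "\<Omega> / (2 * pi) \<notin> \<rat>" "A > 1" "circle_fun f" "finite_order_zeros f" "\<And>t. f t \<ge> 0" "f z = 0"
    and "\<And>t. D 0 t = f t"
    and "\<And>n t. D n t \<ge> 0 \<Longrightarrow> min (A * D n t) (f (t + \<Omega>)) \<le> D (Suc n) (t + \<Omega>)"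
    and "\<And>n t. D n t = 0 \<Longrightarrow> D (Suc n) (t + \<Omega>) = 0"
    and "continuous_on UNIV \<mu>" "\<bar>s\<bar> = 1" "\<And>n y. \<phi> n y = \<mu> y + s * D n y"
    and "\<And>n. continuous_on UNIV (\<phi> n)"
  shows "\<not> uniformly_convergent_on UNIV \<phi> \<and>
    (\<forall>I :: real set. is_interval I \<and> (\<exists>x\<in>I. \<exists>y\<in>I. x < y) \<longrightarrow>
       limsup (\<lambda>n. lip_const I (\<phi> n)) = \<infinity>)"
proof -
  have osc: "\<exists>t c. \<alpha> < t \<and> t < \<beta> \<and> c > 0 \<and>
      (\<forall>\<epsilon> N. \<epsilon> > 0 \<longrightarrow> (\<exists>n\<ge>N. \<exists>y. \<bar>y - t\<bar> < \<epsilon> \<and> c \<le> \<bar>\<phi> n y - \<phi> n t\<bar>))"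
    if ab: "\<alpha> < \<beta>" for \<alpha> \<beta> :: real
  proof -
    obtain t c where t: "\<alpha> < t" "t < \<beta>" "c > 0" "\<And>n. c \<le> D n t"
      "\<And>\<epsilon> N. \<epsilon> > 0 \<Longrightarrow> \<exists>n\<ge>N. \<exists>y. \<bar>y - t\<bar> < \<epsilon> \<and> D n y = 0"
      using oscillation_near_slow_point[of \<Omega> A f z D, OF assms(1-9) ab] by metis
    from persistent_oscillation[OF assms(10-12) t(3-5)] t(1-3) show ?thesis
      by (intro exI[of _ t] exI[of _ "c / 2"]) auto
  qed
  show ?thesis
  proof (intro conjI allI impI)
    obtain t c where "c > 0" "\<And>\<epsilon> N. \<epsilon> > 0 \<Longrightarrow> \<exists>n\<ge>N. \<exists>y. \<bar>y - t\<bar> < \<epsilon> \<and> c \<le> \<bar>\<phi> n y - \<phi> n t\<bar>"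
      using osc[OF zero_less_one] by metis
    then show "\<not> uniformly_convergent_on UNIV \<phi>"
      by (rule not_uniformly_convergent_if_oscillating[OF assms(13)])
  next
    fix I :: "real set" assume I: "is_interval I \<and> (\<exists>x\<in>I. \<exists>y\<in>I. x < y)"
    then obtain x y where xy: "x \<in> I" "y \<in> I" "x < y" by blast
    have sub: "{x<..<y} \<subseteq> I"
    proof
      fix z assume "z \<in> {x<..<y}"
      with I xy(1,2) show "z \<in> I" using mem_is_interval_1_I[of I x y z] by simp
    qed
    obtain t c where t: "x < t" "t < y" "c > 0"
      "\<And>\<epsilon> N. \<epsilon> > 0 \<Longrightarrow> \<exists>n\<ge>N. \<exists>z. \<bar>z - t\<bar> < \<epsilon> \<and> c \<le> \<bar>\<phi> n z - \<phi> n t\<bar>"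
      using osc[OF xy(3)] by metis
    show "limsup (\<lambda>n. lip_const I (\<phi> n)) = \<infinity>"
      by (rule limsup_lip_const_if_oscillating[OF t(3,1,2) sub t(4)])
  qed
qed

section \<open>The four families of maps\<close>

text \<open>The value of \<open>lambda0\<close> at \<open>b = 0\<close>. For \<open>F2\<close> it is
  the fixed point of \<open>x \<mapsto> a * (x - \<delta>)\<close>.\<close>

definition collision_gap :: "map_index \<Rightarrow> real \<Rightarrow> real \<Rightarrow> real" where
  "collision_gap i \<delta> a = (case i of F1 \<Rightarrow> pi / 2 | F2 \<Rightarrow> a * \<delta> / (a - 1) | _ \<Rightarrow> 1)"

text \<open>In the form of maxima and minima, continuity of the fibre maps is immediate and the
  one-step comparisons reduce to linear arithmetic.\<close>

lemma fibre_map_F1_eq: "a > 0 \<Longrightarrow> fibre_map F1 \<delta> a x = max (- (pi / 2)) (min (a * x) (pi / 2))"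
proof -
  assume a: "a > 0"
  have 1: "x < - (pi / (2 * a)) \<longleftrightarrow> a * x < - (pi / 2)" using a by (simp add: field_simps)
  have 2: "\<bar>x\<bar> \<le> pi / (2 * a) \<longleftrightarrow> \<bar>a * x\<bar> \<le> pi / 2" using a by (simp add: field_simps abs_mult)
  show ?thesis unfolding fibre_map.simps 1 2 using pi_ge_zero
    by (auto simp: min_def max_def abs_if simp del: pi_ge_zero)
qed

lemma fibre_map_F2_eq: "\<delta> > 0 \<Longrightarrow> fibre_map F2 \<delta> a x = a * (max (x - \<delta>) 0 + min (x + \<delta>) 0)"
  by (auto simp: min_def max_def abs_if)

lemma fibre_map_F3_eq: "a > 0 \<Longrightarrow> fibre_map F3 \<delta> a x = max (a * x) (- 1)"
  by (auto simp: max_def field_simps)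

lemma fibre_map_F4_eq: "a < 0 \<Longrightarrow> fibre_map F4 \<delta> a x = min (a * x) 1"
  by (auto simp: min_def field_simps)

lemma continuous_fibre_map:
  assumes "if i = F4 then a < 0 else a > 0" "\<delta> > 0"
  shows "continuous_on UNIV (fibre_map i \<delta> a)"
proof (cases i)
  case F1
  hence "fibre_map i \<delta> a = (\<lambda>x. max (- (pi / 2)) (min (a * x) (pi / 2)))"
    using assms fibre_map_F1_eq by auto
  then show ?thesis by (auto intro!: continuous_intros)
next
  case F2
  hence "fibre_map i \<delta> a = (\<lambda>x. a * (max (x - \<delta>) 0 + min (x + \<delta>) 0))"
    using assms fibre_map_F2_eq by auto
  then show ?thesis by (auto intro!: continuous_intros)
next
  case F3
  hence "fibre_map i \<delta> a = (\<lambda>x. max (a * x) (- 1))"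
    using assms fibre_map_F3_eq by auto
  then show ?thesis by (auto intro!: continuous_intros)
next
  case F4
  hence "fibre_map i \<delta> a = (\<lambda>x. min (a * x) 1)"
    using assms fibre_map_F4_eq by auto
  then show ?thesis by (auto intro!: continuous_intros)
qed

text \<open>A negative value at \<open>b\<close> would force \<open>s < 0\<close> and hence a zero
  \<open>K / (- s)\<close> before \<open>b\<close>.\<close>

lemma affine_nonneg_up_to_first_zero:
  fixes K s b :: real
  assumes "K > 0" "b > 0" "\<And>b'. b' > 0 \<Longrightarrow> K + b' * s = 0 \<Longrightarrow> b \<le> b'"
  shows "K + b * s \<ge> 0"
proof (rule ccontr)
  assume neg: "\<not> ?thesis"
  hence s: "s < 0" using assms(1,2) by (smt (verit) mult_nonneg_nonneg)
  hence "b \<le> K / (- s)" by (intro assms(3)) (use assms(1) in \<open>auto simp: divide_neg_neg field_simps\<close>)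
  with s neg show False by (simp add: field_simps)
qed

section \<open>The gap between an iterate and the invariant curve\<close>

locale forced_map =
  fixes i :: map_index and g :: "real \<Rightarrow> real" and \<omega> \<delta> a b :: real
  assumes circle_g: "circle_fun g" and cont_g: "continuous_on UNIV g"
    and \<delta>_pos: "\<delta> > 0" and a_range: "if i = F4 then a < - 1 else a > 1"
    and bif: "is_bifurcation_value i g \<omega> \<delta> a b"
begin

abbreviation "m \<equiv> cohom_sol a \<omega> g"
abbreviation "\<Lambda> \<equiv> lambda0 i g \<omega> \<delta> a b"
abbreviation "T \<equiv> graph_transform i g \<omega> \<delta> a b"
abbreviation "\<mu> \<equiv> mu i g \<omega> \<delta> a b"

text \<open>The distance \<open>D\<close> with its sign: positive above \<open>\<mu>\<close> for
  \<open>F1\<close> and \<open>F4\<close>, below it for \<open>F2\<close> and \<open>F3\<close>, so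
  that \<open>\<phi>\<^sub>0\<close> has gap \<open>\<Lambda>\<close>.\<close>

definition gap :: "(real \<Rightarrow> real) \<Rightarrow> real \<Rightarrow> real" where
  "gap \<phi> \<theta> = - forcing_sign i * (\<phi> \<theta> - \<mu> \<theta>)"

lemma a_gt: "\<bar>a\<bar> > 1"
  using a_range by (auto split: if_splits)

lemma b_pos: "b > 0"
  using bif by (simp add: is_bifurcation_value_def)

lemma collision_gap_pos: "collision_gap i \<delta> a > 0"
  using \<delta>_pos a_range by (cases i) (auto simp: collision_gap_def)

lemma m_shift: "m (\<theta> + \<omega>) = a * m \<theta> + g \<theta>"
  by (rule cohom_sol_eq[OF a_gt circle_g cont_g])

text \<open>All four curves come from the single function \<open>m\<close>. The parameter
  \<open>b'\<close> is kept free because minimality of \<open>b\<close> compares different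
  parameters.\<close>

lemma mu_eq: "mu i g \<omega> \<delta> a b' \<theta> =
    (if i = F2 then a * \<delta> / (a - 1) else 0) + forcing_sign i * b' * m \<theta>"
proof -
  note sol = circle_solution_affine[OF a_gt circle_g cont_g]
  show ?thesis
  proof (cases i)
    case F1
    then show ?thesis using sol[of "\<lambda>\<theta> x. a * x - b' * g \<theta>" 0 "- b'" \<omega>] by simp
  next
    case F2
    have "- (a * \<delta>) / (1 - a) = a * \<delta> / (a - 1)"
      by (metis minus_diff_eq minus_divide_divide)
    then show ?thesis
      using F2 sol[of "\<lambda>\<theta> x. a * (x - \<delta>) + b' * g \<theta>" "- (a * \<delta>)" b' \<omega>]
      by (simp add: right_diff_distrib)
  next
    case F3
    then show ?thesis using sol[of "\<lambda>\<theta> x. a * x + b' * g \<theta>" 0 b' \<omega>] by simp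
  next
    case F4
    then show ?thesis using sol[of "\<lambda>\<theta> x. a * x - b' * g \<theta>" 0 "- b'" \<omega>] by simp
  qed
qed

text \<open>Eliminating \<open>g (\<theta> - \<omega>)\<close> by the cohomological equation cancels
  \<open>m \<theta>\<close> between the two curves, leaving an affine function of
  \<open>b'\<close>.\<close>

lemma lambda0_eq: "lambda0 i g \<omega> \<delta> a b' \<theta> = collision_gap i \<delta> a + b' * (a * m (\<theta> - \<omega>))"
proof -
  have "g (\<theta> - \<omega>) = m \<theta> - a * m (\<theta> - \<omega>)" using m_shift[of "\<theta> - \<omega>"] by simp
  then show ?thesis unfolding lambda0_def mu_eq
    by (cases i) (simp_all add: collision_gap_def right_diff_distrib)
qed

lemma lambda0_nonneg: "\<Lambda> \<theta> \<ge> 0"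
  unfolding lambda0_eq
proof (rule affine_nonneg_up_to_first_zero[OF collision_gap_pos b_pos])
  fix b' :: real assume b': "b' > 0" "collision_gap i \<delta> a + b' * (a * m (\<theta> - \<omega>)) = 0"
  hence "lambda0 i g \<omega> \<delta> a b' \<theta> = 0" by (simp add: lambda0_eq)
  hence "phi0 i g \<omega> b' \<theta> = mu i g \<omega> \<delta> a b' \<theta>" by (auto simp: lambda0_def split: if_splits)
  hence "graphs_meet (mu i g \<omega> \<delta> a b') (phi0 i g \<omega> b')" "graphs_meet (phi0 i g \<omega> b') (mu i g \<omega> \<delta> a b')"
    unfolding graphs_meet_def by metis+
  hence "collision i g \<omega> \<delta> a b'" by (cases i) auto
  then show "b \<le> b'" using bif b'(1) by (simp add: is_bifurcation_value_def)
qed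

text \<open>The collision with \<open>gamma1_tilde\<close> enters only here: up to it, the lower plateau of the first
  fibre map does not move points of the graph of \<open>\<mu>\<close>.\<close>

lemma F1_lower_bound:
  assumes "i = F1"
  shows "b * (a * m \<theta>) \<le> pi / 2"
proof -
  have "pi / 2 + b * (- (a * m \<theta>)) \<ge> 0"
  proof (rule affine_nonneg_up_to_first_zero[OF _ b_pos])
    fix b' :: real assume b': "b' > 0" "pi / 2 + b' * (- (a * m \<theta>)) = 0"
    have "mu i g \<omega> \<delta> a b' (\<theta> + \<omega>) = gamma1_tilde g \<omega> b' (\<theta> + \<omega>)"
      unfolding mu_eq gamma1_tilde_def m_shift using b'(2) assms by (simp add: algebra_simps)
    hence "collision i g \<omega> \<delta> a b'" using assms by (auto simp: graphs_meet_def)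
    then show "b \<le> b'" using bif b'(1) by (simp add: is_bifurcation_value_def)
  qed simp
  then show ?thesis by simp
qed

text \<open>The forcing moves the iterate and \<open>\<mu>\<close> alike, so \<open>g\<close>
  cancels; only the fibre map and the term \<open>b * (a * m \<theta>)\<close> remain.\<close>

lemma gap_graph_transform:
  "gap (T \<phi>) (\<theta> + \<omega>) = - forcing_sign i * (fibre_map i \<delta> a (\<phi> \<theta>)
      - (if i = F2 then a * \<delta> / (a - 1) else 0)) + b * (a * m \<theta>)"
  unfolding gap_def graph_transform_def skew_map_def mu_eq m_shift
  by (cases i) (simp_all add: algebra_simps del: fibre_map.simps)

lemma lambda0_shift: "\<Lambda> (\<theta> + \<omega>) = collision_gap i \<delta> a + b * (a * m \<theta>)"
  by (simp add: lambda0_eq)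

text \<open>Expresses the argument of the affine branch by the gap, so that the one-step comparisons
  involve only \<open>b * (a * m \<theta>)\<close> and the gap.\<close>

lemma scaled_height:
  "a * \<phi> \<theta> = (if i = F2 then a * (a * \<delta> / (a - 1)) else 0)
     + forcing_sign i * (b * (a * m \<theta>)) - forcing_sign i * (a * gap \<phi> \<theta>)"
  unfolding gap_def mu_eq by (cases i) (simp_all add: algebra_simps)

text \<open>For \<open>F2\<close> the first inequality can be strict, where \<open>\<phi> < - \<delta>\<close>; the curves are then not
  monotone in \<open>n\<close>, and zeros of the gap need not stay zeros at the same base point.\<close>

lemma gap_step:
  assumes "i \<noteq> F4"
  shows "gap \<phi> \<theta> \<ge> 0 \<Longrightarrow> min (a * gap \<phi> \<theta>) (\<Lambda> (\<theta> + \<omega>)) \<le> gap (T \<phi>) (\<theta> + \<omega>)"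
    and "gap \<phi> \<theta> = 0 \<Longrightarrow> gap (T \<phi>) (\<theta> + \<omega>) = 0"
proof -
  define y where "y = b * (a * m \<theta>)"
  define d where "d = gap \<phi> \<theta>"
  define d' where "d' = gap (T \<phi>) (\<theta> + \<omega>)"
  have a: "a > 1" using a_range assms by simp
  have nn: "collision_gap i \<delta> a + y \<ge> 0" using lambda0_nonneg[of "\<theta> + \<omega>"] by (simp add: lambda0_shift y_def)
  note * = gap_graph_transform[of \<phi> \<theta>, folded y_def d'_def] scaled_height[of \<phi> \<theta>, folded y_def d_def]
  have "(d \<ge> 0 \<longrightarrow> min (a * d) (collision_gap i \<delta> a + y) \<le> d') \<and> (d = 0 \<longrightarrow> d' = 0)"
  proof (cases i)
    case F1
    have "d' = max (- (pi / 2)) (min (a * \<phi> \<theta>) (pi / 2)) + y" "a * \<phi> \<theta> = - y + a * d"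
      using * F1 a by (simp_all add: fibre_map_F1_eq del: fibre_map.simps)
    \<comment> \<open>Hence \<open>a * \<phi> \<theta> \<ge> - (pi / 2)\<close> whenever
      \<open>d \<ge> 0\<close>: the lower plateau has no effect and \<open>d'\<close> equals the
      minimum.\<close>
    moreover have "y \<le> pi / 2" using F1_lower_bound[OF F1] by (simp add: y_def)
    ultimately show ?thesis using nn F1 by (auto simp: collision_gap_def)
  next
    case F2
    define k where "k = a * \<delta> / (a - 1)"
    have k: "a * k - a * \<delta> = k" using a by (simp add: k_def field_simps)
    have "d' = - (a * (max (\<phi> \<theta> - \<delta>) 0 + min (\<phi> \<theta> + \<delta>) 0) - k) + y" "a * \<phi> \<theta> = a * k + y - a * d"
      using * F2 \<delta>_pos by (simp_all add: fibre_map_F2_eq k_def del: fibre_map.simps)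
    moreover from this k have "a * (\<phi> \<theta> - \<delta>) = k + y - a * d" by (simp add: right_diff_distrib)
    \<comment> \<open>Heights below \<open>- \<delta>\<close> map to negative values, which only
      enlarges the gap, so an upper bound for the fibre map suffices here. Equality, needed for
      zeros, follows next on the upper branch, where \<open>d = 0\<close> lies because
      \<open>k + y \<ge> 0\<close>.\<close>
    moreover have "a * (max (\<phi> \<theta> - \<delta>) 0 + min (\<phi> \<theta> + \<delta>) 0) \<le> max (a * (\<phi> \<theta> - \<delta>)) 0"
      using a \<delta>_pos by (auto simp: max_def min_def mult_le_0_iff zero_le_mult_iff not_le)
    moreover have "a * (max (\<phi> \<theta> - \<delta>) 0 + min (\<phi> \<theta> + \<delta>) 0) = a * (\<phi> \<theta> - \<delta>)"
      if "a * (\<phi> \<theta> - \<delta>) \<ge> 0"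
      using that a \<delta>_pos by (auto simp: max_def min_def zero_le_mult_iff)
    ultimately show ?thesis using nn F2 by (auto simp: collision_gap_def k_def)
  next
    case F3
    have "d' = - max (a * \<phi> \<theta>) (- 1) + y" "a * \<phi> \<theta> = y - a * d"
      using * F3 a by (simp_all add: fibre_map_F3_eq del: fibre_map.simps)
    then show ?thesis using nn F3 by (auto simp: collision_gap_def)
  qed (use assms in simp)
  then show "gap \<phi> \<theta> \<ge> 0 \<Longrightarrow> min (a * gap \<phi> \<theta>) (\<Lambda> (\<theta> + \<omega>)) \<le> gap (T \<phi>) (\<theta> + \<omega>)"
    "gap \<phi> \<theta> = 0 \<Longrightarrow> gap (T \<phi>) (\<theta> + \<omega>) = 0"
    unfolding lambda0_shift d_def d'_def y_def by blast+
qed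

text \<open>The min form of the fibre map gives equality without any sign condition, so it also
  applies to the intermediate curve, whose gap is nonpositive.\<close>

lemma gap_step_F4:
  assumes "i = F4"
  shows "gap (T \<phi>) (\<theta> + \<omega>) = min (a * gap \<phi> \<theta>) (\<Lambda> (\<theta> + \<omega>))"
proof -
  define y where "y = b * (a * m \<theta>)"
  define d where "d = gap \<phi> \<theta>"
  define d' where "d' = gap (T \<phi>) (\<theta> + \<omega>)"
  note * = gap_graph_transform[of \<phi> \<theta>, folded y_def d'_def] scaled_height[of \<phi> \<theta>, folded y_def d_def]
  have "a < 0" using a_range assms by simp
  hence "d' = min (a * \<phi> \<theta>) 1 + y" "a * \<phi> \<theta> = - y + a * d" "collision_gap i \<delta> a = 1"
    using * assms by (simp_all add: fibre_map_F4_eq collision_gap_def del: fibre_map.simps)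
  then show ?thesis
    unfolding lambda0_shift d_def[symmetric] d'_def[symmetric] y_def[symmetric] by (simp add: min_def)
qed

text \<open>Since \<open>a < 0\<close>, the first step turns a nonnegative gap into a nonpositive
  one, which the nonnegative \<open>\<Lambda>\<close> cannot cut off; the second step restores the
  sign and the total factor is \<open>a\<^sup>2\<close>.\<close>

lemma gap_double_step_F4:
  assumes "i = F4" "gap \<phi> \<theta> \<ge> 0"
  shows "gap (T (T \<phi>)) (\<theta> + 2 * \<omega>) = min (a\<^sup>2 * gap \<phi> \<theta>) (\<Lambda> (\<theta> + 2 * \<omega>))"
proof -
  have "a * gap \<phi> \<theta> \<le> 0" using a_range assms by (simp add: mult_nonpos_nonneg)
  hence "gap (T \<phi>) (\<theta> + \<omega>) = a * gap \<phi> \<theta>"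
    using lambda0_nonneg[of "\<theta> + \<omega>"] by (simp add: gap_step_F4[OF assms(1)])
  then show ?thesis using gap_step_F4[OF assms(1), of "T \<phi>" "\<theta> + \<omega>"]
    by (simp add: power2_eq_square add.assoc mult.assoc)
qed

lemma forcing_sign_square: "forcing_sign i * forcing_sign i = 1"
  by (cases i) auto

lemma phi_eq: "\<phi> \<theta> = \<mu> \<theta> + (- forcing_sign i) * gap \<phi> \<theta>"
  unfolding gap_def using forcing_sign_square by (simp add: mult.assoc[symmetric])

lemma gap_phi0: "gap (phi0 i g \<omega> b) \<theta> = \<Lambda> \<theta>"
  unfolding gap_def lambda0_def by (cases i) (simp_all del: mu.simps phi0.simps)

section \<open>Continuity, periodicity and order of zeros\<close>

lemma continuous_mu: "continuous_on UNIV \<mu>"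
proof -
  have "continuous_on UNIV (\<lambda>\<theta>. (if i = F2 then a * \<delta> / (a - 1) else 0) + forcing_sign i * b * m \<theta>)"
    by (intro continuous_intros continuous_cohom_sol a_gt circle_g cont_g)
  then show ?thesis by (simp add: mu_eq cong: continuous_on_cong)
qed

lemma continuous_T:
  assumes "continuous_on UNIV \<phi>"
  shows "continuous_on UNIV (T \<phi>)"
proof -
  have "continuous_on UNIV (\<lambda>\<theta>. fibre_map i \<delta> a (\<phi> (\<theta> - \<omega>)) + forcing_sign i * b * g (\<theta> - \<omega>))"
    using a_range \<delta>_pos
    by (intro continuous_intros continuous_on_compose2[OF continuous_fibre_map]
        continuous_on_compose2[OF assms] continuous_on_compose2[OF cont_g]) auto
  then show ?thesis by (simp add: graph_transform_def skew_map_def)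
qed

lemma continuous_phi: "continuous_on UNIV (phi i g \<omega> \<delta> a b n)"
proof (induction n)
  case 0
  have "continuous_on UNIV (\<lambda>\<theta>. g (\<theta> - \<omega>))"
    by (intro continuous_on_compose2[OF cont_g] continuous_intros) auto
  hence "continuous_on UNIV (\<lambda>\<theta>. phi0 i g \<omega> b \<theta>)"
    by (cases i) (auto intro!: continuous_intros)
  then show ?case by simp
next
  case (Suc n)
  have "phi i g \<omega> \<delta> a b (Suc n) = T (T (phi i g \<omega> \<delta> a b n)) \<or>
      phi i g \<omega> \<delta> a b (Suc n) = T (phi i g \<omega> \<delta> a b n)" by simp
  then show ?case using Suc continuous_T by metis
qed

lemma circle_fun_lambda0: "circle_fun \<Lambda>"
proof -
  have "m (\<theta> + 2 * pi - \<omega>) = m (\<theta> - \<omega>)" for \<theta>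
    using circle_fun_cohom_sol[OF a_gt circle_g cont_g, of \<omega>] unfolding circle_fun_def
    by (metis add_diff_eq diff_add_eq)
  then show ?thesis by (simp add: circle_fun_def lambda0_eq)
qed

lemma continuous_lambda0: "continuous_on UNIV \<Lambda>"
proof -
  have "continuous_on UNIV (\<lambda>\<theta>. collision_gap i \<delta> a + b * (a * m (\<theta> - \<omega>)))"
    by (intro continuous_intros
        continuous_on_compose2[OF continuous_cohom_sol[OF a_gt circle_g cont_g]]) auto
  then show ?thesis by (simp add: lambda0_eq cong: continuous_on_cong)
qed

text \<open>In the analytic case \<open>\<Lambda>\<close> inherits a holomorphic extension from
  \<open>m\<close>. Were it identically zero, \<open>m\<close> would be constant, and by the
  cohomological equation so would \<open>g\<close>.\<close>

lemma finite_order_zeros_lambda0: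
  assumes "\<not> g constant_on UNIV" "real_analytic g \<or> even_order_zeros \<Lambda>"
  shows "finite_order_zeros \<Lambda>"
  using assms(2)
proof
  assume "real_analytic g"
  hence "holo_ext m"
    by (intro holo_ext_cohom_sol a_gt circle_g cont_g real_analytic_imp_holo_ext)
  hence "holo_ext (\<lambda>\<theta>. collision_gap i \<delta> a + (b * a) * m (\<theta> - \<omega>))" by (rule holo_ext_affine_shift)
  moreover have eq: "\<Lambda> = (\<lambda>\<theta>. collision_gap i \<delta> a + (b * a) * m (\<theta> - \<omega>))"
    by (simp add: fun_eq_iff lambda0_eq)
  ultimately have "holo_ext \<Lambda>" by simp
  moreover have "\<exists>\<theta>. \<Lambda> \<theta> \<noteq> 0"
  proof (rule ccontr)
    assume "\<not> ?thesis"
    hence "collision_gap i \<delta> a + (b * a) * m \<theta> = 0" for \<theta>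
      using eq by (metis add_diff_cancel_right')
    hence "m \<theta> = - collision_gap i \<delta> a / (b * a)" for \<theta>
      using b_pos a_gt by (auto simp: field_simps eq_neg_iff_add_eq_0)
    then obtain K where "\<And>\<theta>. m \<theta> = K" by blast
    hence "g \<theta> = K - a * K" for \<theta> using m_shift[of \<theta>] by simp
    with assms(1) show False by (auto simp: constant_on_def)
  qed
  ultimately show ?thesis using holo_ext_imp_finite_order_zeros by blast
qed (rule even_order_zeros_imp_finite_order_zeros[OF continuous_lambda0])

end

text \<open>For constant \<open>g\<close> every \<open>\<phi>\<^sub>n\<close> is constant and has
  Lipschitz constant 0, hence the assumption that \<open>g\<close> is not constant. Intervals of the
  circle appear as intervals on the line, matching the lifts.\<close>

theorem corollary3p12:
  fixes i :: map_index and g :: "real \<Rightarrow> real" and \<omega> \<tau> \<delta> a b :: real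
  assumes "\<omega> / (2 * pi) \<notin> \<rat>"
    and "circle_fun g" and "0 < \<tau>" and "\<tau> \<le> 1" and "C1_hoelder \<tau> g"
    and "\<not> g constant_on UNIV"
    and "\<delta> > 0"
    and "if i = F4 then a < - 1 else a > 1"
    and "is_bifurcation_value i g \<omega> \<delta> a b"
    and "zero_set (lambda0 i g \<omega> \<delta> a b) \<noteq> {}"
    and "real_analytic g \<or> even_order_zeros (lambda0 i g \<omega> \<delta> a b)"
  shows "\<not> uniformly_convergent_on UNIV (phi i g \<omega> \<delta> a b) \<and>
    (\<forall>I :: real set. is_interval I \<and> (\<exists>x\<in>I. \<exists>y\<in>I. x < y) \<longrightarrow>
       limsup (\<lambda>n. lip_const I (phi i g \<omega> \<delta> a b n)) = \<infinity>)"
proof -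
  have "continuous_on UNIV g"
    using assms(5) unfolding C1_hoelder_def
    by (meson DERIV_isCont continuous_at_imp_continuous_on)
  with assms interpret forced_map i g \<omega> \<delta> a b by unfold_locales
  obtain z where z: "\<Lambda> z = 0" using assms(10) by (auto simp: zero_set_def)
  note fin = finite_order_zeros_lambda0[OF assms(6,11)]
  have sign: "\<bar>- forcing_sign i\<bar> = 1" by (cases i) auto
  have D0: "gap (phi i g \<omega> \<delta> a b 0) t = \<Lambda> t" for t by (simp add: gap_phi0)
  have rep: "phi i g \<omega> \<delta> a b n t = \<mu> t + (- forcing_sign i) * gap (phi i g \<omega> \<delta> a b n) t" for n t
    by (rule phi_eq)
  show ?thesis
  proof (cases "i = F4")
    case False
    have "a > 1" using False assms(8) by simp
    then show ?thesis
      by (rule conclusion_from_comparison[where D = "\<lambda>n. gap (phi i g \<omega> \<delta> a b n)", OF assms(1) _ circle_fun_lambda0 fin lambda0_nonneg z D0 _ _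
            continuous_mu sign rep continuous_phi])
        (use False gap_step in simp_all)
  next
    case True
    \<comment> \<open>One step of the sequence applies the fourth map twice, so its base rotation is
      by \<open>2 * \<omega>\<close>, which must be irrational too.\<close>
    have irr: "2 * \<omega> / (2 * pi) \<notin> \<rat>"
    proof
      assume "2 * \<omega> / (2 * pi) \<in> \<rat>"
      hence "2 * \<omega> / (2 * pi) / 2 \<in> \<rat>" by (rule Rats_divide) (rule Rats_number_of)
      with assms(1) show False by (simp add: mult.commute)
    qed
    have step: "phi i g \<omega> \<delta> a b (Suc n) = T (T (phi i g \<omega> \<delta> a b n))" for n
      using True by simp
    have a2: "a\<^sup>2 > 1" using a_gt by (metis one_less_power power2_abs zero_less_numeral)
    show ?thesis
      by (rule conclusion_from_comparison[where D = "\<lambda>n. gap (phi i g \<omega> \<delta> a b n)", OF irr a2 circle_fun_lambda0 fin lambda0_nonneg z D0 _ _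
            continuous_mu sign rep continuous_phi])
        (simp_all only: step gap_double_step_F4[OF True] order.refl, simp add: lambda0_nonneg)
  qed
qed

end
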